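(* Fix $\mathrm{gth}:\mathbb{N}\times[0,1)\to\mathbb{N}$ (increasing in the first argument) and continuity moduli $\{\gamma^{m,n}_G:m<n\}$. (a) Every metric group $G$ with property non-$\mathbf{F}\mathbb{R}$ in $\mathcal{K}_{iso\mathbb{R}}(\mathrm{gth},\gamma^{m,n}_G)$ has an expansion to a structure $A(G,X)$ which belongs to the subclass of $\mathcal{K}_{iso\mathbb{R}}(\mathrm{gth},\gamma^{m,n}_G)$ axiomatized by the family $\{\Theta_{s,m,n}:m<n,\ m,n\in\omega\}$ for some fixed natural number $s\ge1$. (b) The class of structures $A(G,X)$ witnessing property non-$\mathbf{F}\mathbb{R}$ in $\mathcal{K}_{iso\mathbb{R}}(\mathrm{gth},\gamma^{m,n}_G)$ is bountiful.
   Context: An $\mathbb{R}$-tree is a uniquely geodesic metric space ($[x,y]$ the unique geodesic segment) with $[y,x]\cap[x,z]=\{x\}\Rightarrow[y,x]\cup[x,z]=[y,z]$; pointed by $0$, $B_n=\{x:d(0,x)\le n\}$. A metric group is a group with a complete bi-invariant metric of bounded diameter. For an isometric action of $G$ on $X$ and $m\le n$, $x,y\in B_m$: $\circ_{mn}(g,x,y)=\mathrm{length}([g\circ x,y]\cap B_n)$. $A(G,X)$ is the many-sorted continuous structure: sort $G$ ($d,\cdot,{}^{-1},1$), sorts $B_n$ with metric $d$, constant $0$, inclusions $I_{mn}$, and predicates $\circ_{mn}$. Write $a\dot{-}b=\max(a-b,0)$. $\mathcal{K}_{iso\mathbb{R}}(\mathrm{gth},\gamma^{m,n}_G)$ is the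 class of structures in this language where each $\circ_{mn}:G\times B_m\times B_m\to[0,m+n]$ has continuity modulus $\gamma^{m,n}_G$ in $G$ and $\mathrm{id}$ (1-Lipschitz) in each $B_m$-variable (a modulus $\gamma$ means: moving the variable by $<\gamma(\varepsilon)$ changes the value by $<\varepsilon$), satisfying the axioms of groups with bi-invariant metric, the continuous axioms of pointed $\mathbb{R}$-trees (0-hyperbolicity, approximate midpoint property) for the ball sorts, and, for $m<n$: 1(a) $\sup_g\sup_x\min(\circ_{ms}(g,x,0)\dot{-}n,\delta\dot{-}d(1,g))=0$ for $\delta\in[0,1)\cap\mathbb{Q}$, $\mathrm{gth}(m,\delta)\le n<s$; 1(b) $\sup_g\sup_{x,y}\min(|\circ_{ms}(g,x,y)\dot{-}\circ_{m't}(g,I_{mm'}(x),I_{mm'}(y))|,\delta\dot{-}d(1,g))=0$ for $\delta\in[0,1)\cap\mathbb{Q}$, $m<m'$, $\mathrm{gth}(m,\delta)<s<t$, $\mathrm{gth}(m',\delta)<t$; 1(c) $\sup_g\sup_x\min(m\dot{-}\circ_{mn}(g,x,0),\inf_z\max(\circ_{mn}(g,x,z),\sup_u\min(|d(u,z)-\circ_{mn}(g,x,u)|,m\dot{-}d(0,u))))=0$; 2(a) $\sup_g\sup_{x,y_1,y_2}\min(d(y_1,y_2)\dot{-}(\circ_{mn}(g,x,y_1)+\circ_{mn}(g,x,y_2)),m\dot{-}\circ_{mn}(g,x,0))=0$ and $\sup_g\sup_{x,y_1,y_2}\min(\circ_{mn}(g,x,y_1)\dot{-}(d(y_1,y_2)+\circ_{mn}(g,x,y_2)),m\dot{-}\circ_{mn}(g,x,0))=0$;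 2(b) $\sup_g\sup_{x_1,x_2}\min(\sup_y(d(x_1,x_2)\dot{-}(\circ_{mn}(g,x_1,y)+\circ_{mn}(g,x_2,y))),m\dot{-}\circ_{mn}(g,x_1,0),m\dot{-}\circ_{mn}(g,x_2,0))=0$; 2(c) $\sup_g\sup_{x_1,x_2}\min(\inf_y((\circ_{mn}(g,x_1,y)+\circ_{mn}(g,x_2,y))\dot{-}d(x_1,x_2)),m\dot{-}\circ_{mn}(g,x_1,0),m\dot{-}\circ_{mn}(g,x_2,0))=0$; 3(a) $\sup_{x,y}|\circ_{mn}(1,x,y)-d(x,y)|=0$; 3(b) $\sup_g\sup_{x,y}\min(|\circ_{mn}(g,x,y)-\circ_{mn}(g^{-1},y,x)|,m\dot{-}\circ_{mn}(g,x,0),m\dot{-}\circ_{mn}(g^{-1},y,0))=0$; 3(c) $\sup_{x,y,g,g'}\min(\sup_z(\circ_{mn}(gg',x,y)\dot{-}(\circ_{mn}(g^{-1},y,z)+\circ_{mn}(g',x,z))),m\dot{-}\circ_{mn}(g^{-1},y,0),m\dot{-}\circ_{mn}(g',x,0),m\dot{-}\circ_{mn}(gg',x,0))=0$. A metric group $G$ has property non-$\mathbf{F}\mathbb{R}$ in $\mathcal{K}_{iso\mathbb{R}}(\mathrm{gth},\gamma^{m,n}_G)$ if it has an isometric action on an $\mathbb{R}$-tree $X$ without fixed points such that, for some point $0\in X$, the structure $A(G,X)$ belongs to $\mathcal{K}_{iso\mathbb{R}}(\mathrm{gth},\gamma^{m,n}_G)$; such $A(G,X)$ are the structures witnessing this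 property. $\Theta_{s,m,n}$ is the condition $\sup_{v\in B_m}\inf_{g}(\tfrac1s\dot{-}\circ_{mn}(g,v,v))=0$. A class of metric structures is bountiful if for every member $M$ and every infinite subset $C$ of (the union of the sorts of) $M$ there is a member $N$ which is a substructure of $M$ containing $C$ with the density character of $N$ equal to that of $C$. *)

theory Defs
  imports "HOL-Analysis.Analysis" "HOL-Algebra.Group_Action"
begin

section \<open>Metric groups and real trees\<close>

locale metric_group = group G + Metric_space "carrier G" d
  for G :: "('g, 'b) monoid_scheme" (structure) and d :: "'g \<Rightarrow> 'g \<Rightarrow> real" +
  assumes complete: "mcomplete"
    and bounded: "\<exists>b. \<forall>x\<in>carrier G. \<forall>y\<in>carrier G. d x y \<le> b"
    and left_invariant: "\<lbrakk>x \<in> carrier G; y \<in> carrier G; z \<in> carrier G\<rbrakk>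
      \<Longrightarrow> d (z \<otimes> x) (z \<otimes> y) = d x y"
    and right_invariant: "\<lbrakk>x \<in> carrier G; y \<in> carrier G; z \<in> carrier G\<rbrakk>
      \<Longrightarrow> d (x \<otimes> z) (y \<otimes> z) = d x y"

definition geodesic_segment :: "'x set \<Rightarrow> ('x \<Rightarrow> 'x \<Rightarrow> real) \<Rightarrow> 'x \<Rightarrow> 'x \<Rightarrow> 'x set \<Rightarrow> bool" where
  "geodesic_segment X d x y S \<longleftrightarrow> S \<subseteq> X \<and>
     (\<exists>f. f 0 = x \<and> f (d x y) = y \<and> S = f ` {0..d x y} \<and>
       (\<forall>s\<in>{0..d x y}. \<forall>t\<in>{0..d x y}. d (f s) (f t) = \<bar>s - t\<bar>))"

definition segment :: "'x set \<Rightarrow> ('x \<Rightarrow> 'x \<Rightarrow> real) \<Rightarrow> 'x \<Rightarrow> 'x \<Rightarrow> 'x set" where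
  "segment X d x y = (THE S. geodesic_segment X d x y S)"

locale R_tree = Metric_space X d for X :: "'x set" and d :: "'x \<Rightarrow> 'x \<Rightarrow> real" +
  assumes uniquely_geodesic: "\<lbrakk>x \<in> X; y \<in> X\<rbrakk> \<Longrightarrow> \<exists>!S. geodesic_segment X d x y S"
    and segment_join: "\<lbrakk>x \<in> X; y \<in> X; z \<in> X; segment X d y x \<inter> segment X d x z = {x}\<rbrakk>
      \<Longrightarrow> segment X d y x \<union> segment X d x z = segment X d y z"

text \<open>Arc length of a part \<open>A\<close> of a geodesic segment starting at \<open>x\<close>: on such a segment,
  \<open>d x\<close> is the arc-length parameter.\<close>

definition arc_length :: "('x \<Rightarrow> 'x \<Rightarrow> real) \<Rightarrow> 'x \<Rightarrow> 'x set \<Rightarrow> real" where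
  "arc_length d x A = measure lborel (d x ` A)"

definition isometric_action ::
  "('g, 'b) monoid_scheme \<Rightarrow> 'x set \<Rightarrow> ('x \<Rightarrow> 'x \<Rightarrow> real) \<Rightarrow> ('g \<Rightarrow> 'x \<Rightarrow> 'x) \<Rightarrow> bool" where
  "isometric_action G X d \<phi> \<longleftrightarrow> group_action G X \<phi> \<and>
     (\<forall>g\<in>carrier G. \<forall>x\<in>X. \<forall>y\<in>X. d (\<phi> g x) (\<phi> g y) = d x y)"


section \<open>Many-sorted structures\<close>

text \<open>The sorts are the group and, for each \<open>n\<close>, the set \<open>ball M n\<close>; all ball sorts live in one
  type, but the sorts count as pairwise disjoint (see \<open>points\<close> below). The values of the
  symbols outside their sorts are irrelevant, and so are those of \<open>incl M m n\<close> and
  \<open>circ M m n\<close> unless \<open>m \<le> n\<close>.\<close>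

record ('g, 'x) ball_structure =
  grp :: "'g monoid"
  gdist :: "'g \<Rightarrow> 'g \<Rightarrow> real"
  ball :: "nat \<Rightarrow> 'x set"
  bdist :: "nat \<Rightarrow> 'x \<Rightarrow> 'x \<Rightarrow> real"
  base :: "nat \<Rightarrow> 'x"
  incl :: "nat \<Rightarrow> nat \<Rightarrow> 'x \<Rightarrow> 'x"
  circ :: "nat \<Rightarrow> nat \<Rightarrow> 'g \<Rightarrow> 'x \<Rightarrow> 'x \<Rightarrow> real"

hide_const (open) ball

abbreviation gset :: "('g, 'x) ball_structure \<Rightarrow> 'g set" where
  "gset M \<equiv> carrier (grp M)"

abbreviation bset :: "('g, 'x) ball_structure \<Rightarrow> nat \<Rightarrow> 'x set" where
  "bset M \<equiv> ball_structure.ball M"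

definition action_structure ::
  "'g monoid \<Rightarrow> ('g \<Rightarrow> 'g \<Rightarrow> real) \<Rightarrow> 'x set \<Rightarrow> ('x \<Rightarrow> 'x \<Rightarrow> real) \<Rightarrow> 'x \<Rightarrow>
     ('g \<Rightarrow> 'x \<Rightarrow> 'x) \<Rightarrow> ('g, 'x) ball_structure" where
  "action_structure G dG X d p \<phi> =
     \<lparr>grp = G, gdist = dG,
      ball = (\<lambda>n. Metric_space.mcball X d p (real n)),
      bdist = (\<lambda>n. d),
      base = (\<lambda>n. p),
      incl = (\<lambda>m n x. x),
      circ = (\<lambda>m n g x y. arc_length d (\<phi> g x)
        (segment X d (\<phi> g x) y \<inter> Metric_space.mcball X d p (real n)))\<rparr>"

definition dotminus :: "real \<Rightarrow> real \<Rightarrow> real" (infixl \<open>\<dotminus>\<close> 65) where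
  "a \<dotminus> b = max (a - b) 0"

definition has_modulus ::
  "'a set \<Rightarrow> ('a \<Rightarrow> 'a \<Rightarrow> real) \<Rightarrow> (real \<Rightarrow> real) \<Rightarrow> ('a \<Rightarrow> real) \<Rightarrow> bool" where
  "has_modulus A d \<gamma> f \<longleftrightarrow>
     (\<forall>\<epsilon>>0. \<forall>x\<in>A. \<forall>y\<in>A. d x y < \<gamma> \<epsilon> \<longrightarrow> \<bar>f x - f y\<bar> < \<epsilon>)"

definition gromov_product :: "('x \<Rightarrow> 'x \<Rightarrow> real) \<Rightarrow> 'x \<Rightarrow> 'x \<Rightarrow> 'x \<Rightarrow> real" where
  "gromov_product d w x y = (d x w + d y w - d x y) / 2"


section \<open>Axioms\<close>

text \<open>Sorts of a metric structure are complete. The last conjunct says that the image of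
  \<open>incl M m n\<close> is the ball of radius \<open>m\<close> around the base point, so that the ball sorts are the
  balls of a single pointed tree.\<close>

definition pointed_tree_axioms :: "('g, 'x) ball_structure \<Rightarrow> bool" where
  "pointed_tree_axioms M \<longleftrightarrow>
     (\<forall>n. Metric_space (bset M n) (bdist M n) \<and> Metric_space.mcomplete (bset M n) (bdist M n)) \<and>
     (\<forall>n. base M n \<in> bset M n \<and> (\<forall>x\<in>bset M n. bdist M n (base M n) x \<le> real n)) \<and>
     (\<forall>n. (SUP x\<in>bset M n. SUP y\<in>bset M n. SUP z\<in>bset M n. SUP w\<in>bset M n.
        min (gromov_product (bdist M n) w x y) (gromov_product (bdist M n) w y z)
          \<dotminus> gromov_product (bdist M n) w x z) = 0) \<and>
     (\<forall>n. (SUP x\<in>bset M n. SUP y\<in>bset M n. INF z\<in>bset M n.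
        max \<bar>bdist M n x z - bdist M n x y / 2\<bar> \<bar>bdist M n y z - bdist M n x y / 2\<bar>) = 0) \<and>
     (\<forall>m n. m \<le> n \<longrightarrow> incl M m n (base M m) = base M n \<and>
        (\<forall>x\<in>bset M m. incl M m n x \<in> bset M n) \<and>
        (\<forall>x\<in>bset M m. \<forall>y\<in>bset M m.
           bdist M n (incl M m n x) (incl M m n y) = bdist M m x y)) \<and>
     (\<forall>k m n. k \<le> m \<longrightarrow> m \<le> n \<longrightarrow>
        (\<forall>x\<in>bset M k. incl M m n (incl M k m x) = incl M k n x)) \<and>
     (\<forall>m n. m \<le> n \<longrightarrow>
        (SUP x\<in>bset M n. min (real m \<dotminus> bdist M n (base M n) x)
           (INF y\<in>bset M m. bdist M n x (incl M m n y))) = 0)"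

text \<open>The moduli \<open>\<gamma> m n\<close> are only given for \<open>m < n\<close>.\<close>

definition circ_regular :: "(nat \<Rightarrow> nat \<Rightarrow> real \<Rightarrow> real) \<Rightarrow> ('g, 'x) ball_structure \<Rightarrow> bool" where
  "circ_regular \<gamma> M \<longleftrightarrow>
     (\<forall>m n. m \<le> n \<longrightarrow> (\<forall>g\<in>gset M. \<forall>x\<in>bset M m. \<forall>y\<in>bset M m.
        circ M m n g x y \<in> {0..real m + real n})) \<and>
     (\<forall>m n. m < n \<longrightarrow> (\<forall>x\<in>bset M m. \<forall>y\<in>bset M m.
        has_modulus (gset M) (gdist M) (\<gamma> m n) (\<lambda>g. circ M m n g x y))) \<and>
     (\<forall>m n. m \<le> n \<longrightarrow> (\<forall>g\<in>gset M. \<forall>z\<in>bset M m.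
        has_modulus (bset M m) (bdist M m) id (\<lambda>x. circ M m n g x z) \<and>
        has_modulus (bset M m) (bdist M m) id (\<lambda>y. circ M m n g z y)))"

definition circ_growth :: "(nat \<Rightarrow> real \<Rightarrow> nat) \<Rightarrow> ('g, 'x) ball_structure \<Rightarrow> bool" where
  "circ_growth gth M \<longleftrightarrow>
     (\<forall>\<delta>\<in>{0..<1} \<inter> \<rat>. \<forall>m n s. m < n \<longrightarrow> gth m \<delta> \<le> n \<longrightarrow> n < s \<longrightarrow>
        (SUP g\<in>gset M. SUP x\<in>bset M m.
           min (circ M m s g x (base M m) \<dotminus> real n)
               (\<delta> \<dotminus> gdist M \<one>\<^bsub>grp M\<^esub> g)) = 0)"

text \<open>The guards \<open>m < s\<close> and \<open>m' < t\<close> are automatic when \<open>gth m \<delta> \<ge> m\<close>; otherwise they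
  make sure that the two predicates exist.\<close>

definition circ_coherent :: "(nat \<Rightarrow> real \<Rightarrow> nat) \<Rightarrow> ('g, 'x) ball_structure \<Rightarrow> bool" where
  "circ_coherent gth M \<longleftrightarrow>
     (\<forall>\<delta>\<in>{0..<1} \<inter> \<rat>. \<forall>m m' s t. m < m' \<longrightarrow> m < s \<longrightarrow> m' < t \<longrightarrow>
        gth m \<delta> < s \<longrightarrow> s < t \<longrightarrow> gth m' \<delta> < t \<longrightarrow>
        (SUP g\<in>gset M. SUP x\<in>bset M m. SUP y\<in>bset M m.
           min \<bar>circ M m s g x y \<dotminus> circ M m' t g (incl M m m' x) (incl M m m' y)\<bar>
               (\<delta> \<dotminus> gdist M \<one>\<^bsub>grp M\<^esub> g)) = 0)"

definition circ_image :: "('g, 'x) ball_structure \<Rightarrow> bool" where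
  "circ_image M \<longleftrightarrow> (\<forall>m n. m < n \<longrightarrow>
     (SUP g\<in>gset M. SUP x\<in>bset M m.
        min (real m \<dotminus> circ M m n g x (base M m))
            (INF z\<in>bset M m. max (circ M m n g x z)
               (SUP u\<in>bset M m. min \<bar>bdist M m u z - circ M m n g x u\<bar>
                                     (real m \<dotminus> bdist M m (base M m) u)))) = 0)"

definition circ_triangle :: "('g, 'x) ball_structure \<Rightarrow> bool" where
  "circ_triangle M \<longleftrightarrow> (\<forall>m n. m < n \<longrightarrow>
     (SUP g\<in>gset M. SUP x\<in>bset M m. SUP y1\<in>bset M m. SUP y2\<in>bset M m.
        min (bdist M m y1 y2 \<dotminus> (circ M m n g x y1 + circ M m n g x y2))
            (real m \<dotminus> circ M m n g x (base M m))) = 0 \<and>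
     (SUP g\<in>gset M. SUP x\<in>bset M m. SUP y1\<in>bset M m. SUP y2\<in>bset M m.
        min (circ M m n g x y1 \<dotminus> (bdist M m y1 y2 + circ M m n g x y2))
            (real m \<dotminus> circ M m n g x (base M m))) = 0)"

definition circ_isometry_le :: "('g, 'x) ball_structure \<Rightarrow> bool" where
  "circ_isometry_le M \<longleftrightarrow> (\<forall>m n. m < n \<longrightarrow>
     (SUP g\<in>gset M. SUP x1\<in>bset M m. SUP x2\<in>bset M m.
        min (SUP y\<in>bset M m. bdist M m x1 x2 \<dotminus> (circ M m n g x1 y + circ M m n g x2 y))
            (min (real m \<dotminus> circ M m n g x1 (base M m))
                 (real m \<dotminus> circ M m n g x2 (base M m)))) = 0)"

definition circ_isometry_ge :: "('g, 'x) ball_structure \<Rightarrow> bool" where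
  "circ_isometry_ge M \<longleftrightarrow> (\<forall>m n. m < n \<longrightarrow>
     (SUP g\<in>gset M. SUP x1\<in>bset M m. SUP x2\<in>bset M m.
        min (INF y\<in>bset M m. (circ M m n g x1 y + circ M m n g x2 y) \<dotminus> bdist M m x1 x2)
            (min (real m \<dotminus> circ M m n g x1 (base M m))
                 (real m \<dotminus> circ M m n g x2 (base M m)))) = 0)"

definition circ_one :: "('g, 'x) ball_structure \<Rightarrow> bool" where
  "circ_one M \<longleftrightarrow> (\<forall>m n. m < n \<longrightarrow>
     (SUP x\<in>bset M m. SUP y\<in>bset M m.
        \<bar>circ M m n \<one>\<^bsub>grp M\<^esub> x y - bdist M m x y\<bar>) = 0)"

definition circ_inverse :: "('g, 'x) ball_structure \<Rightarrow> bool" where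
  "circ_inverse M \<longleftrightarrow> (\<forall>m n. m < n \<longrightarrow>
     (SUP g\<in>gset M. SUP x\<in>bset M m. SUP y\<in>bset M m.
        min \<bar>circ M m n g x y - circ M m n (inv\<^bsub>grp M\<^esub> g) y x\<bar>
            (min (real m \<dotminus> circ M m n g x (base M m))
                 (real m \<dotminus> circ M m n (inv\<^bsub>grp M\<^esub> g) y (base M m)))) = 0)"

definition circ_mult :: "('g, 'x) ball_structure \<Rightarrow> bool" where
  "circ_mult M \<longleftrightarrow> (\<forall>m n. m < n \<longrightarrow>
     (SUP x\<in>bset M m. SUP y\<in>bset M m. SUP g\<in>gset M. SUP g'\<in>gset M.
        min (SUP z\<in>bset M m. circ M m n (g \<otimes>\<^bsub>grp M\<^esub> g') x y \<dotminus>
               (circ M m n (inv\<^bsub>grp M\<^esub> g) y z + circ M m n g' x z))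
            (min (real m \<dotminus> circ M m n (inv\<^bsub>grp M\<^esub> g) y (base M m))
              (min (real m \<dotminus> circ M m n g' x (base M m))
                   (real m \<dotminus> circ M m n (g \<otimes>\<^bsub>grp M\<^esub> g') x (base M m))))) = 0)"

definition K_isoR ::
  "(nat \<Rightarrow> real \<Rightarrow> nat) \<Rightarrow> (nat \<Rightarrow> nat \<Rightarrow> real \<Rightarrow> real) \<Rightarrow> ('g, 'x) ball_structure set" where
  "K_isoR gth \<gamma> = {M. metric_group (grp M) (gdist M) \<and> pointed_tree_axioms M \<and>
     circ_regular \<gamma> M \<and> circ_growth gth M \<and> circ_coherent gth M \<and> circ_image M \<and>
     circ_triangle M \<and> circ_isometry_le M \<and> circ_isometry_ge M \<and>
     circ_one M \<and> circ_inverse M \<and> circ_mult M}"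

definition Theta :: "nat \<Rightarrow> nat \<Rightarrow> nat \<Rightarrow> ('g, 'x) ball_structure \<Rightarrow> bool" where
  "Theta s m n M \<longleftrightarrow>
     (SUP v\<in>bset M m. INF g\<in>gset M. 1 / real s \<dotminus> circ M m n g v v) = 0"


section \<open>Fixed-point free actions\<close>

definition nonFR_witness ::
  "(nat \<Rightarrow> real \<Rightarrow> nat) \<Rightarrow> (nat \<Rightarrow> nat \<Rightarrow> real \<Rightarrow> real) \<Rightarrow> 'g monoid \<Rightarrow> ('g \<Rightarrow> 'g \<Rightarrow> real) \<Rightarrow>
     'x set \<Rightarrow> ('x \<Rightarrow> 'x \<Rightarrow> real) \<Rightarrow> 'x \<Rightarrow> ('g \<Rightarrow> 'x \<Rightarrow> 'x) \<Rightarrow> bool" where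
  "nonFR_witness gth \<gamma> G dG X d p \<phi> \<longleftrightarrow>
     metric_group G dG \<and> R_tree X d \<and> isometric_action G X d \<phi> \<and>
     \<not> (\<exists>x\<in>X. \<forall>g\<in>carrier G. \<phi> g x = x) \<and>
     p \<in> X \<and> action_structure G dG X d p \<phi> \<in> K_isoR gth \<gamma>"

text \<open>The type argument is the type in which the points of the tree are taken.\<close>

definition nonFR ::
  "'x itself \<Rightarrow> (nat \<Rightarrow> real \<Rightarrow> nat) \<Rightarrow> (nat \<Rightarrow> nat \<Rightarrow> real \<Rightarrow> real) \<Rightarrow>
     'g monoid \<Rightarrow> ('g \<Rightarrow> 'g \<Rightarrow> real) \<Rightarrow> bool" where
  "nonFR (_ :: 'x itself) gth \<gamma> G dG \<longleftrightarrow>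
     (\<exists>(X :: 'x set) d p \<phi>. nonFR_witness gth \<gamma> G dG X d p \<phi>)"

definition nonFR_structures ::
  "(nat \<Rightarrow> real \<Rightarrow> nat) \<Rightarrow> (nat \<Rightarrow> nat \<Rightarrow> real \<Rightarrow> real) \<Rightarrow> ('g, 'x) ball_structure set" where
  "nonFR_structures gth \<gamma> = {action_structure G dG X d p \<phi> | G dG X d p \<phi>.
     nonFR_witness gth \<gamma> G dG X d p \<phi>}"


section \<open>Bountiful classes\<close>

text \<open>The disjoint union of all sorts.\<close>

definition points :: "('g, 'x) ball_structure \<Rightarrow> ('g + nat \<times> 'x) set" where
  "points M = Inl ` gset M \<union> Inr ` (SIGMA n:UNIV. bset M n)"

definition substructure :: "('g, 'x) ball_structure \<Rightarrow> ('g, 'x) ball_structure \<Rightarrow> bool" where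
  "substructure N M \<longleftrightarrow>
     points N \<subseteq> points M \<and>
     \<one>\<^bsub>grp N\<^esub> = \<one>\<^bsub>grp M\<^esub> \<and>
     (\<forall>g\<in>gset N. inv\<^bsub>grp N\<^esub> g = inv\<^bsub>grp M\<^esub> g) \<and>
     (\<forall>g\<in>gset N. \<forall>h\<in>gset N. g \<otimes>\<^bsub>grp N\<^esub> h = g \<otimes>\<^bsub>grp M\<^esub> h \<and> gdist N g h = gdist M g h) \<and>
     (\<forall>n. base N n = base M n) \<and>
     (\<forall>n. \<forall>x\<in>bset N n. \<forall>y\<in>bset N n. bdist N n x y = bdist M n x y) \<and>
     (\<forall>m n. m \<le> n \<longrightarrow> (\<forall>x\<in>bset N m. incl N m n x = incl M m n x)) \<and>
     (\<forall>m n. m \<le> n \<longrightarrow> (\<forall>g\<in>gset N. \<forall>x\<in>bset N m. \<forall>y\<in>bset N m.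
        circ N m n g x y = circ M m n g x y))"

text \<open>Points of different sorts are never close.\<close>

fun close :: "('g, 'x) ball_structure \<Rightarrow> real \<Rightarrow> 'g + nat \<times> 'x \<Rightarrow> 'g + nat \<times> 'x \<Rightarrow> bool" where
  "close M \<epsilon> (Inl g) (Inl h) \<longleftrightarrow> gdist M g h < \<epsilon>"
| "close M \<epsilon> (Inr (m, x)) (Inr (n, y)) \<longleftrightarrow> m = n \<and> bdist M m x y < \<epsilon>"
| "close M \<epsilon> _ _ \<longleftrightarrow> False"

definition dense_subset ::
  "('g, 'x) ball_structure \<Rightarrow> ('g + nat \<times> 'x) set \<Rightarrow> ('g + nat \<times> 'x) set \<Rightarrow> bool" where
  "dense_subset M S D \<longleftrightarrow> D \<subseteq> S \<and> (\<forall>a\<in>S. \<forall>\<epsilon>>0. \<exists>b\<in>D. close M \<epsilon> a b)"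

context includes cardinal_syntax
begin

text \<open>Cardinals are represented by well-orders, up to \<open>=o\<close>.\<close>

definition density_character ::
  "('g, 'x) ball_structure \<Rightarrow> ('g + nat \<times> 'x) set \<Rightarrow> ('g + nat \<times> 'x) rel" where
  "density_character M S =
     |SOME D. dense_subset M S D \<and> (\<forall>E. dense_subset M S E \<longrightarrow> |D| \<le>o |E| )|"

definition bountiful :: "('g, 'x) ball_structure set \<Rightarrow> bool" where
  "bountiful K \<longleftrightarrow> (\<forall>M\<in>K. \<forall>C. C \<subseteq> points M \<longrightarrow> infinite C \<longrightarrow>
     (\<exists>N\<in>K. substructure N M \<and> C \<subseteq> points N \<and>
        density_character N (points N) =o density_character M C))"

end

end

theory Submission
  imports Defs
begin

text \<open>Whenever \<open>circ M m n g x (base M m) < m\<close> in a structure of an action, \<open>\<phi> g x\<close> lies in the ball of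
  radius \<open>m\<close>, and then \<open>circ M m n g x\<close> is the distance to \<open>\<phi> g x\<close>. So all axioms except the
  modulus, growth and coherence axioms hold for every isometric action on a tree with complete
  balls, and those three are inherited pointwise by substructures.

  (a) In a complete tree an isometric action with a bounded orbit has a fixed point. Hence without
  fixed points every \<open>v\<close> is moved by at least \<open>1\<close>, and the moving segment has length at least \<open>1\<close>
  inside the ball of radius \<open>n > m\<close>: \<open>s = 1\<close> works.

  (b) Take a dense subset \<open>D\<close> of \<open>C\<close> of least cardinality and let \<open>H0\<close> be the subgroup generated by the
  group elements in \<open>D\<close> and countably many elements that make the orbit of the base point \<open>p\<close>
  unbounded. The closure \<open>H\<close> of \<open>H0\<close> acts on the closure of the union of the segments \<open>[p, e]\<close>,
  where \<open>e\<close> ranges over the \<open>H0\<close>-orbits of \<open>p\<close> and of the points of \<open>D\<close>; the modulus of \<open>circ\<close> in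
  the group variable makes the action continuous in the group element, which passes invariance
  from \<open>H0\<close> to \<open>H\<close>.\<close>

section \<open>Suprema of nonnegative families\<close>

lemma SUP_eq_0I: "(SUP x\<in>A. f x) = (0::real)" if "A \<noteq> {}" "\<And>x. x \<in> A \<Longrightarrow> f x = 0"
  using that by (simp cong: SUP_cong)

lemma INF_eq_0I:
  fixes f :: "'a \<Rightarrow> real"
  assumes "a \<in> A" "f a = 0" "\<And>x. x \<in> A \<Longrightarrow> 0 \<le> f x"
  shows "(INF x\<in>A. f x) = 0"
proof (rule antisym)
  show "(INF x\<in>A. f x) \<le> 0"
    using assms by (metis bdd_belowI2 cINF_lower)
  show "0 \<le> (INF x\<in>A. f x)"
    using assms by (intro cINF_greatest) auto
qed

lemma SUP_in_interval:
  fixes f :: "'a \<Rightarrow> real"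
  assumes "A \<noteq> {}" "\<And>x. x \<in> A \<Longrightarrow> f x \<in> {0..b}"
  shows "(SUP x\<in>A. f x) \<in> {0..b}"
proof -
  obtain a where a: "a \<in> A" using assms by blast
  have "bdd_above (f ` A)" using assms by (auto intro: bdd_aboveI2[where M = b])
  then have "f a \<le> (SUP x\<in>A. f x)" using a by (rule cSUP_upper2) simp
  moreover have "0 \<le> f a" using assms a by auto
  moreover have "(SUP x\<in>A. f x) \<le> b" using assms by (intro cSUP_least) auto
  ultimately show ?thesis by simp
qed

text \<open>The bound \<open>b\<close> carries the content: over the reals the supremum of an
  unbounded family is an unspecified value, and its vanishing would say nothing about the
  members.\<close>

lemma SUP_eq_0D:
  fixes f :: "'a \<Rightarrow> real"
  assumes "(SUP x\<in>A. f x) = 0" "x \<in> A" "\<And>x. x \<in> A \<Longrightarrow> f x \<in> {0..b}"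
  shows "f x = 0"
proof -
  have "bdd_above (f ` A)" using assms by (auto intro: bdd_aboveI2[where M = b])
  then have "f x \<le> (SUP x\<in>A. f x)" using assms(2) by (rule cSUP_upper2) simp
  then show ?thesis using assms by force
qed

lemma SUP2_eq_0_iff:
  fixes f :: "'a \<Rightarrow> 'b \<Rightarrow> real"
  assumes "A \<noteq> {}" "B \<noteq> {}" "\<And>x y. x \<in> A \<Longrightarrow> y \<in> B \<Longrightarrow> f x y \<in> {0..b}"
  shows "(SUP x\<in>A. SUP y\<in>B. f x y) = 0 \<longleftrightarrow> (\<forall>x\<in>A. \<forall>y\<in>B. f x y = 0)"
proof
  assume *: "(SUP x\<in>A. SUP y\<in>B. f x y) = 0"
  show "\<forall>x\<in>A. \<forall>y\<in>B. f x y = 0"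
  proof (intro ballI)
    fix x y assume xy: "x \<in> A" "y \<in> B"
    have "(SUP y\<in>B. f x y) = 0"
      using * xy(1) SUP_in_interval[OF assms(2,3)] by (rule SUP_eq_0D)
    then show "f x y = 0" using xy(2) assms(3)[OF xy(1)] by (rule SUP_eq_0D)
  qed
qed (intro SUP_eq_0I assms; blast)

lemma dotminus_nonneg: "0 \<le> a \<dotminus> b"
  by (simp add: dotminus_def)

lemma dotminus_eq_0_iff: "a \<dotminus> b = 0 \<longleftrightarrow> a \<le> b"
  by (auto simp: dotminus_def)

lemma dotminus_le: "0 \<le> a \<Longrightarrow> 0 \<le> b \<Longrightarrow> a \<dotminus> b \<le> a"
  by (simp add: dotminus_def)

lemma min_dotminus_eq_0I: "0 \<le> a \<Longrightarrow> (c < b \<Longrightarrow> a = 0) \<Longrightarrow> min a (b \<dotminus> c) = 0"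
  by (cases "c < b") (auto simp: dotminus_def)

section \<open>Complete subspaces\<close>

text \<open>A Cauchy sequence of \<open>S\<close> converges in the whole space, and its limit is
  approximated by the terms of the sequence. Closedness is phrased by such approximation so that
  closures of subgroups and of subtrees fit it directly.\<close>

lemma (in Metric_space) mcomplete_subspace:
  assumes complete: "mcomplete" and S: "S \<subseteq> M"
    and closed: "\<And>x. x \<in> M \<Longrightarrow> (\<And>\<epsilon>. \<epsilon> > 0 \<Longrightarrow> \<exists>y\<in>S. d x y < \<epsilon>) \<Longrightarrow> x \<in> S"
  shows "Metric_space.mcomplete S d"
proof -
  interpret S: Metric_space S d using S by (rule subspace)
  show ?thesis
    unfolding S.mcomplete_def
  proof (intro allI impI)
    fix \<sigma> assume \<sigma>: "S.MCauchy \<sigma>"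
    then have in_S: "\<sigma> n \<in> S" for n by (auto simp: S.MCauchy_def)
    have "MCauchy \<sigma>" using \<sigma> S by (auto simp: S.MCauchy_def MCauchy_def)
    then obtain x where x: "limitin mtopology \<sigma> x sequentially"
      using complete by (auto simp: mcomplete_def)
    then have "x \<in> S"
      by (intro closed) (use in_S in \<open>auto simp: limit_metric_sequentially, metis commute order_refl\<close>)
    then have "limitin S.mtopology \<sigma> x sequentially"
      using x in_S unfolding limit_metric_sequentially S.limit_metric_sequentially by blast
    then show "\<exists>x. limitin S.mtopology \<sigma> x sequentially" ..
  qed
qed

context Metric_space
begin

definition adherence :: "'a set \<Rightarrow> 'a set" where
  "adherence S = {x \<in> M. \<forall>\<epsilon>>0. \<exists>y\<in>S. d x y < \<epsilon>}"

lemma subset_adherence: "S \<subseteq> M \<Longrightarrow> S \<subseteq> adherence S"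
  unfolding adherence_def by (force intro: bexI)

lemma adherence_closed:
  assumes S: "S \<subseteq> M" and x: "x \<in> M" and close: "\<And>\<epsilon>. \<epsilon> > 0 \<Longrightarrow> \<exists>y\<in>adherence S. d x y < \<epsilon>"
  shows "x \<in> adherence S"
  unfolding adherence_def
proof (intro CollectI conjI allI impI x)
  fix e :: real assume "e > 0"
  then obtain y where y: "y \<in> M" "d x y < e / 2" "\<And>\<epsilon>. \<epsilon> > 0 \<Longrightarrow> \<exists>z\<in>S. d y z < \<epsilon>"
    using close[of "e / 2"] unfolding adherence_def by auto
  obtain z where z: "z \<in> S" "d y z < e / 2" using y(3)[OF half_gt_zero[OF \<open>e > 0\<close>]] by blast
  then have "d x z \<le> d x y + d y z" using S x y by (intro triangle) auto
  then show "\<exists>z\<in>S. d x z < e" using y z by (intro bexI[of _ z]) auto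
qed

end

section \<open>Trees as 0-hyperbolic spaces\<close>

text \<open>The four-point inequality is 0-hyperbolicity. It is imposed here because
  \<open>K_isoR\<close> supplies it through its axiom on Gromov products, see
  \<open>tree_action_of_K_isoR\<close>.\<close>

locale hyperbolic_tree = R_tree X d for X :: "'x set" and d :: "'x \<Rightarrow> 'x \<Rightarrow> real" +
  assumes four_point: "\<lbrakk>x \<in> X; y \<in> X; z \<in> X; w \<in> X\<rbrakk>
    \<Longrightarrow> d x z + d y w \<le> max (d x y + d z w) (d x w + d y z)"
begin

lemma geodesic_path:
  assumes "x \<in> X" "y \<in> X"
  obtains f where "f 0 = x" "f (d x y) = y" "f ` {0..d x y} = segment X d x y"
    "\<And>t. t \<in> {0..d x y} \<Longrightarrow> f t \<in> X"
    "\<And>s t. s \<in> {0..d x y} \<Longrightarrow> t \<in> {0..d x y} \<Longrightarrow> d (f s) (f t) = \<bar>s - t\<bar>"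
proof -
  have "geodesic_segment X d x y (segment X d x y)"
    unfolding segment_def by (rule theI') (rule uniquely_geodesic[OF assms])
  then show thesis
    unfolding geodesic_segment_def using that by (smt (verit) image_subset_iff)
qed

lemma point_on_geodesic:
  assumes "x \<in> X" "y \<in> X" "0 \<le> t" "t \<le> d x y"
  obtains z where "z \<in> X" "d x z = t" "d z y = d x y - t"
proof -
  obtain f where f: "f 0 = x" "f (d x y) = y" "f ` {0..d x y} = segment X d x y"
    "\<And>t. t \<in> {0..d x y} \<Longrightarrow> f t \<in> X"
    "\<And>s t. s \<in> {0..d x y} \<Longrightarrow> t \<in> {0..d x y} \<Longrightarrow> d (f s) (f t) = \<bar>s - t\<bar>"
    using geodesic_path assms by metis
  show thesis
    using that[of "f t"] f(1,2,4) f(5)[of 0 t] f(5)[of t "d x y"] assms by auto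
qed

text \<open>Under these hypotheses both sums on the right of the four-point inequality equal
  \<open>d x y\<close>, which leaves \<open>d z w \<le> 0\<close>.\<close>

lemma point_on_geodesic_unique:
  assumes "x \<in> X" "y \<in> X" "z \<in> X" "w \<in> X"
    and "d x z + d z y = d x y" "d x w + d w y = d x y" "d x z = d x w"
  shows "z = w"
proof -
  have "d x y + d z w \<le> max (d x z + d y w) (d x w + d z y)"
    by (rule four_point) (use assms in auto)
  then have "d z w \<le> 0" using assms commute by (smt (verit))
  then show ?thesis using assms by (smt (verit) nonneg zero)
qed

text \<open>Turns the definite description into a metric interval, so that membership becomes an
  equation between distances. A point of the interval coincides with the point of the geodesic at
  the same distance from \<open>x\<close>.\<close>

lemma segment_eq:
  assumes "x \<in> X" "y \<in> X"
  shows "segment X d x y = {z \<in> X. d x z + d z y = d x y}"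
proof -
  obtain f where f: "f 0 = x" "f (d x y) = y" "f ` {0..d x y} = segment X d x y"
    "\<And>t. t \<in> {0..d x y} \<Longrightarrow> f t \<in> X"
    "\<And>s t. s \<in> {0..d x y} \<Longrightarrow> t \<in> {0..d x y} \<Longrightarrow> d (f s) (f t) = \<bar>s - t\<bar>"
    using geodesic_path assms by metis
  have "f t \<in> X \<and> d x (f t) = t \<and> d (f t) y = d x y - t" if "t \<in> {0..d x y}" for t
    using f(1,2,4) f(5)[of 0 t] f(5)[of t "d x y"] that assms by auto
  note ft = this
  have "z \<in> f ` {0..d x y}" if "z \<in> X" "d x z + d z y = d x y" for z
  proof
    show "d x z \<in> {0..d x y}" using that by (smt (verit) nonneg atLeastAtMost_iff)
    then show "z = f (d x z)"
      using that assms ft[of "d x z"] by (intro point_on_geodesic_unique[of x y]) auto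
  qed
  then show ?thesis using ft unfolding f(3)[symmetric] by auto
qed

text \<open>This is the tripod shape of triangles: a geodesic from \<open>w\<close> to
  \<open>x\<close> or one from \<open>w\<close> to \<open>y\<close> passes through
  \<open>z\<close>.\<close>

lemma four_point_segment:
  assumes "x \<in> X" "y \<in> X" "z \<in> X" "w \<in> X" "d x z + d z y = d x y"
  shows "d w z \<le> max (d w x - d x z) (d w y - d z y)"
proof -
  have "d x y + d z w \<le> max (d x z + d y w) (d x w + d z y)"
    by (rule four_point) (use assms in auto)
  then show ?thesis using assms commute by (smt (verit))
qed

text \<open>Balls are convex: seen from the centre, no point of a segment is farther away than the
  farther endpoint.\<close>

lemma mcball_segment:
  assumes "x \<in> mcball p r" "y \<in> mcball p r" "z \<in> X" "d x z + d z y = d x y"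
  shows "z \<in> mcball p r"
proof -
  have "d p z \<le> max (d p x - d x z) (d p y - d z y)"
    by (rule four_point_segment) (use assms in auto)
  then show ?thesis using assms by (auto intro: order_trans)
    (smt (verit) nonneg)
qed

text \<open>Arc length is a Lebesgue measure, so comparing lengths needs measurability. In the
  arc-length parameter the part inside the ball is a sublevel set of a 1-Lipschitz function, hence
  closed.\<close>

lemma image_segment_Int_mcball:
  assumes "a \<in> X" "y \<in> X" "p \<in> X"
  shows "d a ` (segment X d a y \<inter> mcball p r) \<in> sets borel"
    and "d a ` (segment X d a y \<inter> mcball p r) \<subseteq> {0..d a y}"
proof -
  obtain f where f: "f 0 = a" "f (d a y) = y" "f ` {0..d a y} = segment X d a y"
    "\<And>t. t \<in> {0..d a y} \<Longrightarrow> f t \<in> X"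
    "\<And>s t. s \<in> {0..d a y} \<Longrightarrow> t \<in> {0..d a y} \<Longrightarrow> d (f s) (f t) = \<bar>s - t\<bar>"
    using geodesic_path assms by metis
  have df: "d a (f t) = t" if "t \<in> {0..d a y}" for t
    using f(1) f(5)[of 0 t] that by auto
  have "d a ` (segment X d a y \<inter> mcball p r) = {t \<in> {0..d a y}. d p (f t) \<le> r}"
    using f(4) assms(3) df unfolding f(3)[symmetric] by force
  moreover have "1-lipschitz_on {0..d a y} (\<lambda>t. d p (f t))"
  proof (rule lipschitz_onI)
    fix s t assume st: "s \<in> {0..d a y}" "t \<in> {0..d a y}"
    have "d p (f s) \<le> d p (f t) + d (f t) (f s)" "d p (f t) \<le> d p (f s) + d (f s) (f t)"
      by (auto intro!: triangle assms f st)
    then show "dist (d p (f s)) (d p (f t)) \<le> 1 * dist s t"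
      using f(5)[OF st] by (simp add: dist_real_def commute)
  qed simp
  then have "closed {t \<in> {0..d a y}. d p (f t) \<le> r}"
    by (intro continuous_on_closed_Collect_le lipschitz_on_continuous_on continuous_on_const)
      auto
  ultimately show "d a ` (segment X d a y \<inter> mcball p r) \<in> sets borel"
    by simp
  show "d a ` (segment X d a y \<inter> mcball p r) \<subseteq> {0..d a y}"
    using df unfolding f(3)[symmetric] by auto
qed

text \<open>By convexity the ball cuts nothing off the segment, and \<open>d a\<close> maps the
  segment onto the whole interval up to \<open>d a y\<close>.\<close>

lemma arc_length_segment_mcball:
  assumes "a \<in> mcball p r" "y \<in> mcball p r"
  shows "arc_length d a (segment X d a y \<inter> mcball p r) = d a y"
proof -
  have X: "a \<in> X" "y \<in> X" using assms by auto
  have "t \<in> d a ` (segment X d a y \<inter> mcball p r)" if t: "t \<in> {0..d a y}" for t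
  proof -
    obtain z where z: "z \<in> X" "d a z = t" "d z y = d a y - t"
      using point_on_geodesic X t by (metis atLeastAtMost_iff)
    then have "z \<in> mcball p r" by (intro mcball_segment[OF assms]) auto
    then show ?thesis using z X by (intro image_eqI[of _ _ z]) (auto simp: segment_eq)
  qed
  then have "d a ` (segment X d a y \<inter> mcball p r) = {0..d a y}"
    using image_segment_Int_mcball(2)[OF X, of p r] assms by auto
  then show ?thesis by (simp add: arc_length_def)
qed

text \<open>The last stretch of length \<open>s - r\<close> before \<open>y\<close> stays in the
  ball of radius \<open>s\<close>, and the segment is at least that long because it starts outside
  this ball. This is what separates small values of \<open>circ\<close> from points that have left
  the ball.\<close>

lemma arc_length_segment_outside:
  assumes "a \<in> X" "a \<notin> mcball p s" "y \<in> mcball p r"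
  shows "s - r \<le> arc_length d a (segment X d a y \<inter> mcball p s)"
proof (cases "r \<le> s")
  case True
  have X: "y \<in> X" "p \<in> X" using assms by auto
  have "d p a > s" "d p y \<le> r" using assms by auto
  then have far: "s - r \<le> d a y" using triangle[of p y a] X assms commute by (smt (verit))
  have "t \<in> d a ` (segment X d a y \<inter> mcball p s)" if t: "t \<in> {d a y - (s - r)..d a y}" for t
  proof -
    obtain z where z: "z \<in> X" "d a z = t" "d z y = d a y - t"
      using point_on_geodesic[of a y t] X assms t far by auto
    have "d p z \<le> d p y + d y z" by (rule triangle) (use X z in auto)
    then have "z \<in> mcball p s" using t z X \<open>d p y \<le> r\<close> commute[of y z] by auto
    then show ?thesis using z X assms by (intro image_eqI[of _ _ z]) (auto simp: segment_eq)
  qed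
  then have "measure lborel {d a y - (s - r)..d a y}
      \<le> measure lborel (d a ` (segment X d a y \<inter> mcball p s))"
    using image_segment_Int_mcball[OF assms(1) X, of s]
    by (intro measure_mono_fmeasurable fmeasurableI2[OF fmeasurable_cbox])
      (auto simp flip: box_real)
  then show ?thesis using True by (simp add: arc_length_def)
next
  case False
  then show ?thesis by (smt (verit) arc_length_def measure_nonneg)
qed

end

section \<open>Isometric actions on trees\<close>

text \<open>Completeness is required of the balls only, since these are the sorts of the
  structure.\<close>

locale tree_action = grp: metric_group G dG + hyperbolic_tree X d
  for G :: "'g monoid" (structure) and dG :: "'g \<Rightarrow> 'g \<Rightarrow> real"
    and X :: "'x set" and d :: "'x \<Rightarrow> 'x \<Rightarrow> real" +
  fixes p :: 'x and \<phi> :: "'g \<Rightarrow> 'x \<Rightarrow> 'x"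
  assumes action: "isometric_action G X d \<phi>"
    and base_point: "p \<in> X"
    and complete_balls: "Metric_space.mcomplete (mcball p (real n)) d"
begin

abbreviation "struct \<equiv> action_structure G dG X d p \<phi>"

lemma struct_sel [simp]:
  "grp struct = G" "gdist struct = dG" "bset struct n = mcball p (real n)" "bdist struct n = d"
  "base struct n = p" "incl struct m n x = x"
  by (simp_all add: action_structure_def)

lemma circ_struct: "circ struct m n g x y =
    arc_length d (\<phi> g x) (segment X d (\<phi> g x) y \<inter> mcball p (real n))"
  by (simp add: action_structure_def)

lemma circ_nonneg: "0 \<le> circ struct m n g x y"
  by (simp add: circ_struct arc_length_def)

lemma group_action: "group_action G X \<phi>"
  using action by (simp add: isometric_action_def)

lemma act_closed [simp]: "g \<in> carrier G \<Longrightarrow> x \<in> X \<Longrightarrow> \<phi> g x \<in> X"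
  using group_action.element_image[OF group_action] by blast

lemma act_dist [simp]: "g \<in> carrier G \<Longrightarrow> x \<in> X \<Longrightarrow> y \<in> X \<Longrightarrow> d (\<phi> g x) (\<phi> g y) = d x y"
  using action by (auto simp: isometric_action_def)

lemma act_one [simp]: "x \<in> X \<Longrightarrow> \<phi> \<one> x = x"
  using group_action.id_eq_one[OF group_action] by (metis restrict_apply)

lemma act_mult: "x \<in> X \<Longrightarrow> g \<in> carrier G \<Longrightarrow> h \<in> carrier G \<Longrightarrow> \<phi> (g \<otimes> h) x = \<phi> g (\<phi> h x)"
  by (rule group_action.composition_rule[OF group_action])

lemma act_inv [simp]: "x \<in> X \<Longrightarrow> g \<in> carrier G \<Longrightarrow> \<phi> g (\<phi> (inv g) x) = x"
  using act_mult[of x g "inv g"] by simp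

lemma act_swap:
  assumes "g \<in> carrier G" "x \<in> X" "y \<in> X"
  shows "d (\<phi> g x) y = d x (\<phi> (inv g) y)"
  using act_dist[of g x "\<phi> (inv g) y"] assms by simp

lemma p_in_mcball [simp]: "p \<in> mcball p (real n)"
  using base_point by simp

lemma circ_eq_dist:
  assumes "\<phi> g x \<in> mcball p (real n)" "y \<in> mcball p (real n)"
  shows "circ struct m n g x y = d (\<phi> g x) y"
  unfolding circ_struct by (rule arc_length_segment_mcball[OF assms])

lemma circ_outside:
  assumes "g \<in> carrier G" "x \<in> X" "\<phi> g x \<notin> mcball p (real n)" "y \<in> mcball p (real m)"
  shows "real n - real m \<le> circ struct m' n g x y"
  unfolding circ_struct by (rule arc_length_segment_outside) (use assms in auto)

text \<open>Outside the ball of radius \<open>n\<close> the value would be at least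
  \<open>n - m\<close>, which is at least 1 for naturals \<open>m < n\<close>.\<close>

lemma dist_act_le_circ:
  assumes "m < n" "g \<in> carrier G" "x \<in> X" "y \<in> mcball p (real m)" "circ struct m' n g x y < 1"
  shows "\<phi> g x \<in> mcball p (real n)" "d (\<phi> g x) y = circ struct m' n g x y"
proof -
  show in_ball: "\<phi> g x \<in> mcball p (real n)"
    using circ_outside[of g x n y m m'] assms by force
  have "y \<in> mcball p (real n)" using assms by auto
  with in_ball show "d (\<phi> g x) y = circ struct m' n g x y"
    by (simp add: circ_eq_dist del: in_mcball)
qed

text \<open>Were \<phi> g x outside the ball of radius \<open>n\<close>, the segment to the centre
  would have length at least \<open>n > m\<close> inside it. So the value is the true distance to
  \<open>p\<close>, and it is below \<open>m\<close>. This evaluates every guard of the form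
  \<open>real m \<dotminus> circ ...\<close> in the axioms.\<close>

lemma circ_base_less:
  assumes "m < n" "g \<in> carrier G" "x \<in> X" "circ struct m' n g x p < real m"
  shows "\<phi> g x \<in> mcball p (real m)"
    and "y \<in> mcball p (real m) \<Longrightarrow> circ struct k n g x y = d (\<phi> g x) y"
proof -
  have in_ball: "\<phi> g x \<in> mcball p (real n)"
    using circ_outside[of g x n p 0 m'] assms base_point by force
  then have "d (\<phi> g x) p < real m"
    using assms by (metis circ_eq_dist p_in_mcball)
  then show "\<phi> g x \<in> mcball p (real m)"
    using assms base_point commute by auto
  assume "y \<in> mcball p (real m)"
  then have "y \<in> mcball p (real n)" using assms by auto
  with in_ball show "circ struct k n g x y = d (\<phi> g x) y"
    by (rule circ_eq_dist)
qed

section \<open>The axioms that hold for every tree action\<close>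

lemma struct_metric_space: "Metric_space (mcball p r) d"
  by (rule subspace) auto

lemma pointed_tree_axioms_struct: "pointed_tree_axioms struct"
proof -
  let ?B = "\<lambda>n::nat. mcball p (real n)"
  have gromov: "(SUP x\<in>?B n. SUP y\<in>?B n. SUP z\<in>?B n. SUP w\<in>?B n.
        min (gromov_product d w x y) (gromov_product d w y z) \<dotminus> gromov_product d w x z) = 0" for n
  proof (intro SUP_eq_0I)
    fix x y z w assume "x \<in> ?B n" "y \<in> ?B n" "z \<in> ?B n" "w \<in> ?B n"
    then have "d x z + d y w \<le> max (d x y + d z w) (d x w + d y z)"
      by (intro four_point) auto
    then show "min (gromov_product d w x y) (gromov_product d w y z) \<dotminus> gromov_product d w x z = 0"
      unfolding dotminus_eq_0_iff gromov_product_def by (simp add: min_def max_def split: if_splits)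
  qed (use p_in_mcball in blast)+
  have midpoint: "(SUP x\<in>?B n. SUP y\<in>?B n. INF z\<in>?B n.
        max \<bar>d x z - d x y / 2\<bar> \<bar>d y z - d x y / 2\<bar>) = 0" for n
  proof (intro SUP_eq_0I)
    fix x y assume xy: "x \<in> ?B n" "y \<in> ?B n"
    \<comment> \<open>An exact midpoint exists on the geodesic, and convexity of the ball keeps it
      in the sort, so the infimum is attained.\<close>
    then obtain z where z: "z \<in> X" "d x z = d x y / 2" "d z y = d x y - d x y / 2"
      using point_on_geodesic[of x y "d x y / 2"] by auto
    show "(INF z\<in>?B n. max \<bar>d x z - d x y / 2\<bar> \<bar>d y z - d x y / 2\<bar>) = 0"
    proof (rule INF_eq_0I)
      show "z \<in> ?B n" using z by (intro mcball_segment[OF xy]) auto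
      show "max \<bar>d x z - d x y / 2\<bar> \<bar>d y z - d x y / 2\<bar> = 0"
        using z commute[of z y] by simp
    qed simp
  qed (use p_in_mcball in blast)+
  have image: "(SUP x\<in>?B n. min (real m \<dotminus> d p x) (INF y\<in>?B m. d x y)) = 0" for m n
  proof (intro SUP_eq_0I)
    fix x assume x: "x \<in> ?B n"
    show "min (real m \<dotminus> d p x) (INF y\<in>?B m. d x y) = 0"
    proof (subst min.commute, rule min_dotminus_eq_0I)
      show "0 \<le> (INF y\<in>?B m. d x y)"
        by (intro cINF_greatest) (use p_in_mcball in blast, simp)
      show "(INF y\<in>?B m. d x y) = 0" if "d p x < real m"
        by (rule INF_eq_0I[of x]) (use x that in auto)
    qed
  qed (use p_in_mcball in blast)
  show ?thesis
    unfolding pointed_tree_axioms_def struct_sel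
    by (intro conjI allI impI ballI struct_metric_space complete_balls gromov midpoint image
        p_in_mcball) (auto intro: order_trans)
qed

text \<open>The witness is \<open>z = \<phi> g x\<close> itself: then \<open>d u z\<close> and
  \<open>circ\<close> agree at every \<open>u\<close> of the ball.\<close>

lemma circ_image_struct: "circ_image struct"
  unfolding circ_image_def struct_sel
proof (intro allI impI SUP_eq_0I)
  fix m n g x assume m: "m < n" and g: "g \<in> carrier G" and x: "x \<in> mcball p (real m)"
  let ?B = "mcball p (real m)"
  let ?S = "\<lambda>z. SUP u\<in>?B. min \<bar>d u z - circ struct m n g x u\<bar> (real m \<dotminus> d p u)"
  \<comment> \<open>Where the guard vanishes nothing is known about \<open>circ\<close>. The second
    argument of \<open>min\<close> still bounds the family by \<open>m\<close>, so the supremum is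
    meaningful and nonnegative.\<close>
  have S: "?S z \<in> {0..real m}" for z
    by (rule SUP_in_interval) (use p_in_mcball in blast, simp add: dotminus_def min_le_iff_disj)
  show "min (real m \<dotminus> circ struct m n g x p)
      (INF z\<in>?B. max (circ struct m n g x z) (?S z)) = 0"
  proof (subst min.commute, rule min_dotminus_eq_0I)
    have S0: "0 \<le> max (circ struct m n g x z) (?S z)" for z
      using S[of z] by (simp add: le_max_iff_disj)
    show "0 \<le> (INF z\<in>?B. max (circ struct m n g x z) (?S z))"
      by (intro cINF_greatest S0) (use p_in_mcball in blast)
    assume small: "circ struct m n g x p < real m"
    have gx: "\<phi> g x \<in> ?B" and eq: "\<And>y. y \<in> ?B \<Longrightarrow> circ struct m n g x y = d (\<phi> g x) y"
      using circ_base_less[OF m g _ small] x by auto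
    show "(INF z\<in>?B. max (circ struct m n g x z) (?S z)) = 0"
    proof (rule INF_eq_0I[OF gx _ S0])
      have "?S (\<phi> g x) = 0"
        by (rule SUP_eq_0I) (use p_in_mcball in blast, simp add: eq commute dotminus_nonneg del: in_mcball)
      then show "max (circ struct m n g x (\<phi> g x)) (?S (\<phi> g x)) = 0"
        using gx eq[OF gx] by auto
    qed
  qed
qed (use p_in_mcball grp.one_closed in blast)+

lemma circ_triangle_struct: "circ_triangle struct"
  unfolding circ_triangle_def struct_sel
proof (intro allI impI conjI SUP_eq_0I)
  fix m n g x y1 y2
  assume m: "m < n" and g: "g \<in> carrier G" and xy: "x \<in> mcball p (real m)"
    "y1 \<in> mcball p (real m)" "y2 \<in> mcball p (real m)"
  have gx: "\<phi> g x \<in> X" using g xy by auto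
  show "min (d y1 y2 \<dotminus> (circ struct m n g x y1 + circ struct m n g x y2))
      (real m \<dotminus> circ struct m n g x p) = 0"
  proof (rule min_dotminus_eq_0I[OF dotminus_nonneg])
    assume "circ struct m n g x p < real m"
    then have "circ struct m n g x y1 = d (\<phi> g x) y1" "circ struct m n g x y2 = d (\<phi> g x) y2"
      using circ_base_less(2) m g xy by auto
    then show "d y1 y2 \<dotminus> (circ struct m n g x y1 + circ struct m n g x y2) = 0"
      using triangle''[of y1 "\<phi> g x" y2] xy gx by (auto simp: dotminus_eq_0_iff)
  qed
  show "min (circ struct m n g x y1 \<dotminus> (d y1 y2 + circ struct m n g x y2))
      (real m \<dotminus> circ struct m n g x p) = 0"
  proof (rule min_dotminus_eq_0I[OF dotminus_nonneg])
    assume "circ struct m n g x p < real m"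
    then have "circ struct m n g x y1 = d (\<phi> g x) y1" "circ struct m n g x y2 = d (\<phi> g x) y2"
      using circ_base_less(2) m g xy by auto
    then show "circ struct m n g x y1 \<dotminus> (d y1 y2 + circ struct m n g x y2) = 0"
      using triangle'[of "\<phi> g x" y2 y1] xy gx by (auto simp: dotminus_eq_0_iff)
  qed
qed (use p_in_mcball grp.one_closed in blast)+

lemma circ_isometry_le_struct: "circ_isometry_le struct"
  unfolding circ_isometry_le_def struct_sel
proof (intro allI impI SUP_eq_0I)
  fix m n g x1 x2
  assume m: "m < n" and g: "g \<in> carrier G" and x: "x1 \<in> mcball p (real m)"
    "x2 \<in> mcball p (real m)"
  let ?S = "SUP y\<in>mcball p (real m). d x1 x2 \<dotminus> (circ struct m n g x1 y + circ struct m n g x2 y)"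
  have "?S \<in> {0..d x1 x2}"
    by (rule SUP_in_interval)
      (use p_in_mcball in blast, simp add: dotminus_nonneg dotminus_le circ_nonneg)
  then have S: "0 \<le> ?S" by simp
  show "min ?S (min (real m \<dotminus> circ struct m n g x1 p) (real m \<dotminus> circ struct m n g x2 p)) = 0"
  proof (cases "circ struct m n g x1 p < real m \<and> circ struct m n g x2 p < real m")
    case True
    have "?S = 0"
    proof (rule SUP_eq_0I)
      fix y assume y: "y \<in> mcball p (real m)"
      then have "circ struct m n g x1 y = d (\<phi> g x1) y" "circ struct m n g x2 y = d (\<phi> g x2) y"
        using circ_base_less(2) m g x True by auto
      then show "d x1 x2 \<dotminus> (circ struct m n g x1 y + circ struct m n g x2 y) = 0"
        using triangle'[of "\<phi> g x1" y "\<phi> g x2"] act_dist[of g x1 x2] x y g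
        by (auto simp: dotminus_eq_0_iff)
    qed (use p_in_mcball in blast)
    then show ?thesis by (simp add: dotminus_nonneg)
  next
    case False
    then show ?thesis using S by (auto simp: dotminus_def)
  qed
qed (use p_in_mcball grp.one_closed in blast)+

text \<open>The infimum is attained at \<open>y = \<phi> g x1\<close>, where the first summand
  vanishes and the second is \<open>d x2 x1\<close> because \<open>g\<close> is an isometry.\<close>

lemma circ_isometry_ge_struct: "circ_isometry_ge struct"
  unfolding circ_isometry_ge_def struct_sel
proof (intro allI impI SUP_eq_0I)
  fix m n g x1 x2
  assume m: "m < n" and g: "g \<in> carrier G" and x: "x1 \<in> mcball p (real m)"
    "x2 \<in> mcball p (real m)"
  let ?S = "INF y\<in>mcball p (real m). circ struct m n g x1 y + circ struct m n g x2 y \<dotminus> d x1 x2"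
  have S: "0 \<le> ?S"
    by (intro cINF_greatest dotminus_nonneg) (use p_in_mcball in blast)
  show "min ?S (min (real m \<dotminus> circ struct m n g x1 p) (real m \<dotminus> circ struct m n g x2 p)) = 0"
  proof (cases "circ struct m n g x1 p < real m \<and> circ struct m n g x2 p < real m")
    case True
    then have gx: "\<phi> g x1 \<in> mcball p (real m)"
      using circ_base_less(1) m g x by auto
    then have "circ struct m n g x1 (\<phi> g x1) = 0"
      "circ struct m n g x2 (\<phi> g x1) = d (\<phi> g x2) (\<phi> g x1)"
      using circ_base_less(2)[OF m g _ _ gx] x True by auto
    then have "?S = 0"
      using g x commute by (intro INF_eq_0I[OF gx] dotminus_nonneg) (auto simp: dotminus_eq_0_iff)
    then show ?thesis by (simp add: dotminus_nonneg)
  next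
    case False
    then show ?thesis using S by (auto simp: dotminus_def)
  qed
qed (use p_in_mcball grp.one_closed in blast)+

lemma circ_one_struct: "circ_one struct"
  unfolding circ_one_def struct_sel
proof (intro allI impI SUP_eq_0I)
  fix m n x y assume "(m::nat) < n" "x \<in> mcball p (real m)" "y \<in> mcball p (real m)"
  then show "\<bar>circ struct m n \<one> x y - d x y\<bar> = 0"
    by (subst circ_eq_dist) auto
qed (use p_in_mcball in blast)+

lemma circ_inverse_struct: "circ_inverse struct"
  unfolding circ_inverse_def struct_sel
proof (intro allI impI SUP_eq_0I)
  fix m n g x y
  assume m: "m < n" and g: "g \<in> carrier G" and xy: "x \<in> mcball p (real m)" "y \<in> mcball p (real m)"
  show "min \<bar>circ struct m n g x y - circ struct m n (inv g) y x\<bar>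
      (min (real m \<dotminus> circ struct m n g x p) (real m \<dotminus> circ struct m n (inv g) y p)) = 0"
  proof (cases "circ struct m n g x p < real m \<and> circ struct m n (inv g) y p < real m")
    case True
    then have "circ struct m n g x y = d (\<phi> g x) y" "circ struct m n (inv g) y x = d (\<phi> (inv g) y) x"
      using circ_base_less(2) m g xy by auto
    then have "circ struct m n g x y = circ struct m n (inv g) y x"
      using act_swap[of g x y] g xy commute by auto
    then show ?thesis by (simp add: dotminus_nonneg)
  next
    case False
    then show ?thesis by (auto simp: dotminus_def)
  qed
qed (use p_in_mcball grp.one_closed in blast)+

lemma circ_mult_struct: "circ_mult struct"
  unfolding circ_mult_def struct_sel
proof (intro allI impI SUP_eq_0I)
  fix m n g g' x y
  assume m: "m < n" and g: "g \<in> carrier G" "g' \<in> carrier G"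
    and xy: "x \<in> mcball p (real m)" "y \<in> mcball p (real m)"
  let ?S = "SUP z\<in>mcball p (real m). circ struct m n (g \<otimes> g') x y \<dotminus>
      (circ struct m n (inv g) y z + circ struct m n g' x z)"
  have "?S \<in> {0..circ struct m n (g \<otimes> g') x y}"
    by (rule SUP_in_interval)
      (use p_in_mcball in blast, simp add: dotminus_nonneg dotminus_le circ_nonneg)
  then have S: "0 \<le> ?S" by simp
  show "min ?S (min (real m \<dotminus> circ struct m n (inv g) y p)
      (min (real m \<dotminus> circ struct m n g' x p) (real m \<dotminus> circ struct m n (g \<otimes> g') x p))) = 0"
  proof (cases "circ struct m n (inv g) y p < real m \<and> circ struct m n g' x p < real m \<and>
      circ struct m n (g \<otimes> g') x p < real m")
    case True
    have "?S = 0"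
    proof (rule SUP_eq_0I)
      fix z assume z: "z \<in> mcball p (real m)"
      then have "circ struct m n (inv g) y z = d (\<phi> (inv g) y) z"
        "circ struct m n g' x z = d (\<phi> g' x) z" "circ struct m n (g \<otimes> g') x y = d (\<phi> (g \<otimes> g') x) y"
        using circ_base_less(2) m g xy True by auto
      \<comment> \<open>Moving \<open>g\<close> to the other argument turns the axiom into the
        triangle inequality through \<open>z\<close>.\<close>
      moreover have "d (\<phi> (g \<otimes> g') x) y = d (\<phi> g' x) (\<phi> (inv g) y)"
        using act_mult act_swap g xy by auto
      ultimately show "circ struct m n (g \<otimes> g') x y \<dotminus>
          (circ struct m n (inv g) y z + circ struct m n g' x z) = 0"
        using triangle'[of "\<phi> g' x" z "\<phi> (inv g) y"] xy z g by (auto simp: dotminus_eq_0_iff)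
    qed (use p_in_mcball in blast)
    then show ?thesis by (simp add: dotminus_nonneg)
  next
    case False
    then show ?thesis using S by (auto simp: dotminus_def)
  qed
qed (use p_in_mcball grp.one_closed in blast)+

text \<open>Only the axioms that involve the moduli or \<open>gth\<close> constrain the particular
  action; membership of a restricted action is reduced to them.\<close>

theorem struct_in_K_isoR_iff:
  "struct \<in> K_isoR gth \<gamma> \<longleftrightarrow>
     circ_regular \<gamma> struct \<and> circ_growth gth struct \<and> circ_coherent gth struct"
  by (simp add: K_isoR_def grp.metric_group_axioms pointed_tree_axioms_struct circ_image_struct
      circ_triangle_struct circ_isometry_le_struct circ_isometry_ge_struct circ_one_struct
      circ_inverse_struct circ_mult_struct)

end

text \<open>Any four points lie in one ball of integer radius, and the 0-hyperbolicity axiom of that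
  sort applies to them. Gromov products are bounded on a ball, which allows the four nested suprema
  to be peeled off one at a time.\<close>

lemma tree_action_of_K_isoR:
  fixes G :: "'g monoid"
  assumes "metric_group G dG" "R_tree X d" "isometric_action G X d \<phi>" and p: "p \<in> X"
    and K: "action_structure G dG X d p \<phi> \<in> K_isoR gth \<gamma>"
  shows "tree_action G dG X d p \<phi>"
proof -
  interpret grp: metric_group G dG by fact
  interpret R_tree X d by fact
  let ?B = "\<lambda>n::nat. mcball p (real n)"
  have axioms: "pointed_tree_axioms (action_structure G dG X d p \<phi>)"
    using K by (simp add: K_isoR_def)
  show ?thesis
  proof
    show "isometric_action G X d \<phi>" "p \<in> X" by fact+
    show "Metric_space.mcomplete (?B n) d" for n
      using axioms by (simp add: pointed_tree_axioms_def action_structure_def)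
    fix x y z w assume X: "x \<in> X" "y \<in> X" "z \<in> X" "w \<in> X"
    let ?f = "\<lambda>x y z w. min (gromov_product d w x y) (gromov_product d w y z) \<dotminus> gromov_product d w x z"
    define n where "n = nat \<lceil>max (max (d p x) (d p y)) (max (d p z) (d p w))\<rceil>"
    have n: "x \<in> ?B n" "y \<in> ?B n" "z \<in> ?B n" "w \<in> ?B n"
      unfolding n_def using X p by (auto, linarith+)
    have gromov: "gromov_product d w x y \<in> {0..2 * real n}"
      if "x \<in> ?B n" "y \<in> ?B n" "w \<in> ?B n" for x y w
    proof -
      have "d x w \<le> d p x + d p w" "d y w \<le> d p y + d p w" "d x y \<le> d x w + d y w"
        using that triangle'' triangle' by auto
      then show ?thesis using that by (auto simp: gromov_product_def) (smt (verit) nonneg)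
    qed
    have f: "?f x y z w \<in> {0..2 * real n}"
      if "x \<in> ?B n" "y \<in> ?B n" "z \<in> ?B n" "w \<in> ?B n" for x y z w
      using gromov[of x y w] gromov[of x z w] that by (auto simp: dotminus_def)
    have ne: "?B n \<noteq> {}" using n by blast
    have "(SUP x\<in>?B n. SUP y\<in>?B n. SUP z\<in>?B n. SUP w\<in>?B n. ?f x y z w) = 0"
      using axioms by (simp add: pointed_tree_axioms_def action_structure_def)
    then have "(SUP y\<in>?B n. SUP z\<in>?B n. SUP w\<in>?B n. ?f x y z w) = 0"
      by (rule SUP_eq_0D[where b = "2 * real n"]) (intro n SUP_in_interval f ne; assumption)+
    then have "(SUP z\<in>?B n. SUP w\<in>?B n. ?f x y z w) = 0"
      by (rule SUP_eq_0D[where b = "2 * real n"]) (intro n SUP_in_interval f ne; assumption)+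
    then have "(SUP w\<in>?B n. ?f x y z w) = 0"
      by (rule SUP_eq_0D[where b = "2 * real n"]) (intro n SUP_in_interval f ne; assumption)+
    then have "?f x y z w = 0"
      by (rule SUP_eq_0D[OF _ n(4) f[OF n(1-3)]])
    then show "d x z + d y w \<le> max (d x y + d z w) (d x w + d y z)"
      unfolding dotminus_eq_0_iff gromov_product_def by (simp add: min_def max_def split: if_splits)
  qed
qed

section \<open>Pointwise axioms, bounded orbits and continuity in the group element\<close>

context tree_action
begin

text \<open>The truncation by \<delta> bounds the family, so the vanishing supremum is a pointwise
  statement, and such a statement passes to subsets.\<close>

lemma circ_growth_struct_iff:
  "circ_growth gth struct \<longleftrightarrow>
     (\<forall>\<delta>\<in>{0..<1} \<inter> \<rat>. \<forall>m n s. m < n \<longrightarrow> gth m \<delta> \<le> n \<longrightarrow> n < s \<longrightarrow>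
        (\<forall>g\<in>carrier G. \<forall>x\<in>mcball p (real m).
           min (circ struct m s g x p \<dotminus> real n) (\<delta> \<dotminus> dG \<one> g) = 0))"
proof -
  have "(SUP g\<in>carrier G. SUP x\<in>mcball p (real m).
        min (circ struct m s g x p \<dotminus> real n) (\<delta> \<dotminus> dG \<one> g)) = 0 \<longleftrightarrow>
      (\<forall>g\<in>carrier G. \<forall>x\<in>mcball p (real m).
           min (circ struct m s g x p \<dotminus> real n) (\<delta> \<dotminus> dG \<one> g) = 0)"
    if "\<delta> \<in> {0..<1} \<inter> \<rat>" for \<delta> m n s
  proof (rule SUP2_eq_0_iff)
    show "min (circ struct m s g x p \<dotminus> real n) (\<delta> \<dotminus> dG \<one> g) \<in> {0..\<delta>}" for g x
      using that by (auto simp: dotminus_nonneg dotminus_le min_le_iff_disj)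
  qed (use p_in_mcball grp.one_closed in blast)+
  then show ?thesis
    unfolding circ_growth_def struct_sel by (intro ball_cong refl) (simp only:)
qed

lemma circ_coherent_struct_iff:
  "circ_coherent gth struct \<longleftrightarrow>
     (\<forall>\<delta>\<in>{0..<1} \<inter> \<rat>. \<forall>m m' s t. m < m' \<longrightarrow> m < s \<longrightarrow> m' < t \<longrightarrow>
        gth m \<delta> < s \<longrightarrow> s < t \<longrightarrow> gth m' \<delta> < t \<longrightarrow>
        (\<forall>g\<in>carrier G. \<forall>x\<in>mcball p (real m). \<forall>y\<in>mcball p (real m).
           min \<bar>circ struct m s g x y \<dotminus> circ struct m' t g x y\<bar> (\<delta> \<dotminus> dG \<one> g) = 0))"
proof -
  have "(SUP g\<in>carrier G. SUP x\<in>mcball p (real m). SUP y\<in>mcball p (real m).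
        min \<bar>circ struct m s g x y \<dotminus> circ struct m' t g x y\<bar> (\<delta> \<dotminus> dG \<one> g)) = 0 \<longleftrightarrow>
      (\<forall>g\<in>carrier G. \<forall>x\<in>mcball p (real m). \<forall>y\<in>mcball p (real m).
        min \<bar>circ struct m s g x y \<dotminus> circ struct m' t g x y\<bar> (\<delta> \<dotminus> dG \<one> g) = 0)"
    if "\<delta> \<in> {0..<1} \<inter> \<rat>" for \<delta> m m' s t
  proof -
    let ?f = "\<lambda>g x y. min \<bar>circ struct m s g x y \<dotminus> circ struct m' t g x y\<bar> (\<delta> \<dotminus> dG \<one> g)"
    have f: "?f g x y \<in> {0..\<delta>}" for g x y
      using that by (auto simp: dotminus_nonneg dotminus_le min_le_iff_disj)
    have ne: "carrier G \<noteq> {}" "mcball p (real m) \<noteq> {}"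
      using p_in_mcball grp.one_closed by blast+
    \<comment> \<open>The two outer suprema are removed together, with the inner supremum as the
      function.\<close>
    have "(SUP g\<in>carrier G. SUP x\<in>mcball p (real m). SUP y\<in>mcball p (real m). ?f g x y) = 0 \<longleftrightarrow>
      (\<forall>g\<in>carrier G. \<forall>x\<in>mcball p (real m). (SUP y\<in>mcball p (real m). ?f g x y) = 0)"
      by (intro SUP2_eq_0_iff[where b = \<delta>] SUP_in_interval ne f)
    also have "\<dots> \<longleftrightarrow> (\<forall>g\<in>carrier G. \<forall>x\<in>mcball p (real m). \<forall>y\<in>mcball p (real m). ?f g x y = 0)"
    proof (intro ball_cong refl iffI ballI)
      show "?f g x y = 0" if "(SUP y\<in>mcball p (real m). ?f g x y) = 0" "y \<in> mcball p (real m)" for g x y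
        using that f by (rule SUP_eq_0D)
    qed (intro SUP_eq_0I ne, blast)
    finally show ?thesis .
  qed
  then show ?thesis
    unfolding circ_coherent_def struct_sel by (intro ball_cong refl) (simp only:)
qed

text \<open>A circumcentre argument: in a tree the points whose distance to every orbit point is
  nearly at most half the diameter lie close together, so completeness yields an exact centre. The
  group permutes the orbit, hence fixes this centre.\<close>

theorem fixed_point_of_bounded_orbit:
  assumes x: "x \<in> X" and bound: "\<And>g. g \<in> carrier G \<Longrightarrow> d x (\<phi> g x) \<le> b"
  shows "\<exists>c\<in>X. \<forall>g\<in>carrier G. \<phi> g c = c"
proof -
  define Orb where "Orb = (\<lambda>g. \<phi> g x) ` carrier G"
  define D where "D = (SUP (u, v)\<in>Orb \<times> Orb. d u v)"
  have OX: "Orb \<subseteq> X" using x by (auto simp: Orb_def)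
  have invar: "\<phi> g w \<in> Orb" if gw: "g \<in> carrier G" "w \<in> Orb" for g w
  proof -
    obtain h where "h \<in> carrier G" "w = \<phi> h x" using gw by (auto simp: Orb_def)
    then show ?thesis using gw(1) x act_mult[of x g h] \<open>h \<in> carrier G\<close> \<open>w = \<phi> h x\<close>
      unfolding Orb_def by (intro image_eqI[of _ _ "g \<otimes> h"]) auto
  qed
  have "Orb \<noteq> {}" using grp.one_closed by (auto simp: Orb_def)
  have "d u v \<le> 2 * b" if "u \<in> Orb" "v \<in> Orb" for u v
  proof -
    have "d x u \<le> b" "d x v \<le> b" using that bound by (auto simp: Orb_def)
    moreover have "u \<in> X" "v \<in> X" using that OX by auto
    ultimately show ?thesis using triangle''[of u x v] x by linarith
  qed
  then have bdd: "bdd_above ((\<lambda>(u, v). d u v) ` (Orb \<times> Orb))" by (auto intro!: bdd_aboveI2[where M = "2 * b"])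
  have le_D: "d u v \<le> D" if "u \<in> Orb" "v \<in> Orb" for u v
    unfolding D_def using cSUP_upper[OF _ bdd, of "(u, v)"] that by auto
  have almost_D: "\<exists>u\<in>Orb. \<exists>v\<in>Orb. D - e < d u v" if "e > 0" for e
  proof -
    have "D - e < (SUP (u, v)\<in>Orb \<times> Orb. d u v)" using that by (simp add: D_def)
    then show ?thesis
      by (subst (asm) less_cSUP_iff[OF _ bdd]) (use \<open>Orb \<noteq> {}\<close> in auto)
  qed
  \<comment> \<open>Approximate centres of the orbit are close to each other, since the orbit has almost
    diametral pairs.\<close>
  define centre where "centre e u \<longleftrightarrow> u \<in> X \<and> (\<forall>w\<in>Orb. d w u \<le> D / 2 + e)" for e u
  have close: "d u v \<le> 3 * e" if "centre e u" "centre e v" "e > 0" for u v e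
  proof -
    obtain a b where ab: "a \<in> Orb" "b \<in> Orb" "D - e < d a b" using almost_D[OF \<open>e > 0\<close>] by blast
    have "d a b + d u v \<le> max (d a u + d b v) (d a v + d u b)"
      by (rule four_point) (use ab OX that in \<open>auto simp: centre_def\<close>)
    moreover have "d a u \<le> D / 2 + e" "d b v \<le> D / 2 + e" "d a v \<le> D / 2 + e" "d b u \<le> D / 2 + e"
      using that ab by (auto simp: centre_def)
    ultimately show ?thesis using ab(3) commute[of u b] by linarith
  qed
  \<comment> \<open>Completeness is available in balls only, so the centres are sought in a ball
    containing the whole orbit.\<close>
  define n where "n = nat \<lceil>d p x + b\<rceil>"
  have O_ball: "w \<in> mcball p (real n)" if "w \<in> Orb" for w
  proof -
    have "d p w \<le> d p x + d x w" using triangle base_point x that OX by blast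
    also have "d x w \<le> b" using that bound by (auto simp: Orb_def)
    finally show ?thesis using that OX base_point unfolding n_def by (auto, linarith)
  qed
  have "\<exists>z\<in>mcball p (real n). centre e z" if "e > 0" for e
  proof -
    obtain a b where ab: "a \<in> Orb" "b \<in> Orb" "D - e < d a b" using almost_D[OF \<open>e > 0\<close>] by blast
    \<comment> \<open>The midpoint of an almost diametral pair is an approximate centre:
      \<open>four_point_segment\<close> subtracts half of \<open>d a b\<close> from an orbit
      distance of at most \<open>D\<close>.\<close>
    then obtain z where z: "z \<in> X" "d a z = d a b / 2" "d z b = d a b - d a b / 2"
      using point_on_geodesic[of a b "d a b / 2"] OX by auto
    have "d w z \<le> D / 2 + e" if "w \<in> Orb" for w
    proof -
      have "d w z \<le> max (d w a - d a z) (d w b - d z b)"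
        by (rule four_point_segment) (use that ab OX z in auto)
      then show ?thesis using le_D[OF that ab(1)] le_D[OF that ab(2)] ab(3) z \<open>e > 0\<close> by linarith
    qed
    moreover have "z \<in> mcball p (real n)"
      using O_ball[OF ab(1)] O_ball[OF ab(2)] z(1) by (rule mcball_segment) (use z in auto)
    ultimately show ?thesis using z(1) unfolding centre_def by blast
  qed
  then have "\<exists>z\<in>mcball p (real n). centre (1 / real (Suc k)) z" for k by simp
  then obtain z where z: "\<And>k. z k \<in> mcball p (real n)" "\<And>k. centre (1 / real (Suc k)) (z k)"
    by metis
  have centre_mono: "centre e u \<Longrightarrow> e \<le> e' \<Longrightarrow> centre e' u" for e e' u
    unfolding centre_def by (meson add_left_mono order_trans)
  interpret B: Metric_space "mcball p (real n)" d by (rule struct_metric_space)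
  have z_eventually: "\<exists>N. \<forall>k\<ge>N. centre e (z k)" if e: "e > 0" for e
  proof -
    obtain N where "1 / real (Suc N) < e" using e nat_approx_posE by blast
    then have "1 / real (Suc k) \<le> e" if "k \<ge> N" for k
      using that by (smt (verit) frac_le of_nat_0_less_iff of_nat_mono Suc_le_mono zero_less_Suc)
    then show ?thesis using z(2) centre_mono by blast
  qed
  have "B.MCauchy z"
    unfolding B.MCauchy_def
  proof (intro conjI allI impI)
    fix e :: real assume "e > 0"
    then obtain N where "\<forall>k\<ge>N. centre (e / 4) (z k)" using z_eventually[of "e / 4"] by auto
    then have "d (z k) (z k') < e" if "k \<ge> N" "k' \<ge> N" for k k'
      using close[of "e / 4" "z k" "z k'"] that \<open>e > 0\<close> by auto
    then show "\<exists>N. \<forall>k k'. N \<le> k \<longrightarrow> N \<le> k' \<longrightarrow> d (z k) (z k') < e" by blast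
  qed (use z in auto)
  then obtain c where "limitin B.mtopology z c sequentially"
    using complete_balls[of n] by (auto simp: B.mcomplete_def)
  then have "c \<in> mcball p (real n)" and lim: "\<And>e. e > 0 \<Longrightarrow> \<exists>N. \<forall>k\<ge>N. d (z k) c < e"
    unfolding B.limit_metric_sequentially by blast+
  then have c: "c \<in> X" by simp
  have centre_c: "centre e c" if e: "e > 0" for e
    unfolding centre_def
  proof (intro conjI ballI c)
    fix w assume w: "w \<in> Orb"
    obtain N1 where N1: "\<And>k. k \<ge> N1 \<Longrightarrow> centre (e / 2) (z k)"
      using z_eventually[OF half_gt_zero[OF e]] by blast
    obtain N2 where N2: "\<And>k. k \<ge> N2 \<Longrightarrow> d (z k) c < e / 2"
      using lim[OF half_gt_zero[OF e]] by blast
    let ?k = "max N1 N2"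
    have "d w c \<le> d w (z ?k) + d (z ?k) c" using w OX c z(1)[of ?k] by (intro triangle) auto
    moreover have "d w (z ?k) \<le> D / 2 + e / 2" using N1[of ?k] w by (simp add: centre_def)
    moreover have "d (z ?k) c < e / 2" using N2[of ?k] by simp
    ultimately show "d w c \<le> D / 2 + e" by linarith
  qed
  have "\<phi> g c = c" if g: "g \<in> carrier G" for g
  proof (rule ccontr)
    assume "\<phi> g c \<noteq> c"
    then have pos: "d c (\<phi> g c) > 0" using g c by auto
    \<comment> \<open>Two centres with error \<open>e\<close> are at most \<open>3 * e\<close>
      apart, which contradicts a distance of \<open>4 * e\<close>.\<close>
    define e where "e = d c (\<phi> g c) / 4"
    have e: "e > 0" using pos by (simp add: e_def)
    have "d w (\<phi> g c) \<le> D / 2 + e" if w: "w \<in> Orb" for w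
    proof -
      have "w \<in> X" using w OX by blast
      then have "d w (\<phi> g c) = d (\<phi> (inv g) w) c"
        using act_swap[of "inv g" w c] g c by simp
      moreover have "\<phi> (inv g) w \<in> Orb" using invar g w by simp
      ultimately show ?thesis using centre_c[OF e] by (simp add: centre_def)
    qed
    then have "centre e (\<phi> g c)" using g c by (simp add: centre_def)
    then have "d c (\<phi> g c) \<le> 3 * e" using close[OF centre_c[OF e] _ e] by simp
    then show False using pos by (simp add: e_def)
  qed
  then show ?thesis using c by blast
qed

text \<open>No orbit is bounded by 1, so some \<open>g\<close> moves \<open>v\<close> by more than
  1. The value at this \<open>g\<close> cannot be below 1, since such a value would be the true
  displacement.\<close>

lemma Theta_of_no_fixed_point:
  assumes "\<not> (\<exists>c\<in>X. \<forall>g\<in>carrier G. \<phi> g c = c)" and m: "m < n"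
  shows "Theta 1 m n struct"
  unfolding Theta_def struct_sel
proof (rule SUP_eq_0I)
  fix v assume v: "v \<in> mcball p (real m)"
  then obtain g where g: "g \<in> carrier G" "1 < d v (\<phi> g v)"
    using fixed_point_of_bounded_orbit[of v 1] assms(1) by force
  have "1 \<le> circ struct m n g v v"
    using dist_act_le_circ(2)[OF m g(1) _ v, of v m] v g commute by force
  then show "(INF g\<in>carrier G. 1 / real 1 \<dotminus> circ struct m n g v v) = 0"
    by (intro INF_eq_0I[OF g(1)] dotminus_nonneg) (simp add: dotminus_eq_0_iff)
qed (use p_in_mcball in blast)

text \<open>With \<phi> g x as second tree argument, \<open>circ\<close> vanishes at
  \<open>g\<close>, so the modulus makes it small at nearby \<open>h\<close>. Small values of
  \<open>circ\<close> are true distances.\<close>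

lemma act_continuous:
  assumes regular: "circ_regular \<gamma> struct" and \<gamma>: "\<And>m n \<epsilon>. m < n \<Longrightarrow> \<epsilon> > 0 \<Longrightarrow> \<gamma> m n \<epsilon> > 0"
    and g: "g \<in> carrier G" and x: "x \<in> X" and "\<epsilon> > 0"
  shows "\<exists>\<delta>>0. \<forall>h\<in>carrier G. dG g h < \<delta> \<longrightarrow> d (\<phi> g x) (\<phi> h x) < \<epsilon>"
proof -
  define m where "m = nat \<lceil>max (d p x) (d p (\<phi> g x))\<rceil>"
  have m: "x \<in> mcball p (real m)" "\<phi> g x \<in> mcball p (real m)"
    unfolding m_def using x g base_point by (auto, linarith+)
  \<comment> \<open>The cap at 1 is the threshold below which \<open>dist_act_le_circ\<close>
    identifies the value with a distance.\<close>
  define e where "e = min \<epsilon> 1"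
  have "e > 0" using \<open>\<epsilon> > 0\<close> by (simp add: e_def)
  have "d (\<phi> g x) (\<phi> h x) < \<epsilon>" if h: "h \<in> carrier G" "dG g h < \<gamma> m (Suc m) e" for h
  proof -
    let ?c = "\<lambda>h. circ struct m (Suc m) h x (\<phi> g x)"
    have "\<bar>?c g - ?c h\<bar> < e"
      using regular h g \<open>e > 0\<close> m unfolding circ_regular_def has_modulus_def struct_sel by blast
    moreover have "?c g = 0"
      using m by (subst circ_eq_dist) auto
    ultimately have "?c h < e" by linarith
    then show ?thesis
      using dist_act_le_circ(2)[of m "Suc m" h x "\<phi> g x" m] h x m commute by (auto simp: e_def)
  qed
  moreover have "\<gamma> m (Suc m) e > 0" using \<gamma> \<open>e > 0\<close> by simp
  ultimately show ?thesis by blast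
qed

end

section \<open>Subtrees and restricted actions\<close>

lemma has_modulus_subset:
  assumes "has_modulus A d \<gamma> f" "B \<subseteq> A" "\<And>x. x \<in> B \<Longrightarrow> g x = f x"
  shows "has_modulus B d \<gamma> g"
  unfolding has_modulus_def
proof (intro allI impI ballI)
  fix \<epsilon> :: real and x y assume "\<epsilon> > 0" and xy: "x \<in> B" "y \<in> B" and "d x y < \<gamma> \<epsilon>"
  moreover have "x \<in> A" "y \<in> A" using xy assms(2) by auto
  ultimately have "\<bar>f x - f y\<bar> < \<epsilon>" using assms(1) by (simp add: has_modulus_def)
  then show "\<bar>g x - g y\<bar> < \<epsilon>" using xy assms(3) by simp
qed

context hyperbolic_tree
begin

definition geodesically_convex :: "'x set \<Rightarrow> bool" where
  "geodesically_convex S \<longleftrightarrow>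
     S \<subseteq> X \<and> (\<forall>x\<in>S. \<forall>y\<in>S. \<forall>z\<in>X. d x z + d z y = d x y \<longrightarrow> z \<in> S)"

lemma geodesically_convex_subset: "geodesically_convex S \<Longrightarrow> S \<subseteq> X"
  by (simp add: geodesically_convex_def)

lemma geodesically_convexD:
  "\<lbrakk>geodesically_convex S; x \<in> S; y \<in> S; z \<in> X; d x z + d z y = d x y\<rbrakk> \<Longrightarrow> z \<in> S"
  unfolding geodesically_convex_def by blast

lemma segment_subset_convex:
  assumes S: "geodesically_convex S" and xy: "x \<in> S" "y \<in> S"
  shows "segment X d x y \<subseteq> S"
proof -
  have "x \<in> X" "y \<in> X" using geodesically_convex_subset[OF S] xy by auto
  then show ?thesis using geodesically_convexD[OF S xy] by (auto simp: segment_eq)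
qed

lemma geodesic_segment_convex:
  assumes S: "geodesically_convex S" and xy: "x \<in> S" "y \<in> S"
  shows "geodesic_segment S d x y T \<longleftrightarrow> geodesic_segment X d x y T"
proof
  have X: "x \<in> X" "y \<in> X" using geodesically_convex_subset[OF S] xy by auto
  assume T: "geodesic_segment X d x y T"
  then have T_eq: "T = segment X d x y"
    unfolding segment_def by (rule the1_equality[OF uniquely_geodesic[OF X], symmetric])
  with T show "geodesic_segment S d x y T"
    using segment_subset_convex[OF assms] unfolding geodesic_segment_def by metis
next
  assume "geodesic_segment S d x y T"
  moreover have "S \<subseteq> X" using S by (rule geodesically_convex_subset)
  ultimately show "geodesic_segment X d x y T"
    unfolding geodesic_segment_def by (metis subset_trans)
qed

text \<open>\<open>segment\<close> depends on the ambient set. This equality is the reason why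
  \<open>circ\<close> computed in a subtree agrees with \<open>circ\<close> of the whole
  tree.\<close>

lemma segment_convex:
  assumes "geodesically_convex S" "x \<in> S" "y \<in> S"
  shows "segment S d x y = segment X d x y"
  unfolding segment_def geodesic_segment_convex[OF assms] ..

lemma hyperbolic_tree_convex:
  assumes S: "geodesically_convex S"
  shows "hyperbolic_tree S d"
proof -
  have SX: "S \<subseteq> X" using S by (rule geodesically_convex_subset)
  interpret S: Metric_space S d using SX by (rule subspace)
  show ?thesis
  proof
    fix x y assume "x \<in> S" "y \<in> S"
    then show "\<exists>!T. geodesic_segment S d x y T"
      unfolding geodesic_segment_convex[OF S \<open>x \<in> S\<close> \<open>y \<in> S\<close>]
      using SX by (intro uniquely_geodesic) auto
  next
    fix x y z assume "x \<in> S" "y \<in> S" "z \<in> S" "segment S d y x \<inter> segment S d x z = {x}"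
    then show "segment S d y x \<union> segment S d x z = segment S d y z"
      using SX unfolding segment_convex[OF S \<open>y \<in> S\<close> \<open>x \<in> S\<close>] segment_convex[OF S \<open>x \<in> S\<close> \<open>z \<in> S\<close>]
        segment_convex[OF S \<open>y \<in> S\<close> \<open>z \<in> S\<close>] by (intro segment_join) auto
  next
    fix x y z w assume "x \<in> S" "y \<in> S" "z \<in> S" "w \<in> S"
    then show "d x z + d y w \<le> max (d x y + d z w) (d x w + d y z)"
      using SX by (intro four_point) auto
  qed
qed

text \<open>Replace the endpoints by nearby points of \<open>S\<close> and compare \<open>z\<close>
  with the point of the new segment at nearly the same parameter; \<open>four_point_segment\<close>
  bounds the distance of the two.\<close>

lemma geodesically_convex_adherence:
  assumes S: "geodesically_convex S"
  shows "geodesically_convex (adherence S)"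
  unfolding geodesically_convex_def
proof (intro conjI ballI impI)
  show "adherence S \<subseteq> X" by (auto simp: adherence_def)
  have SX: "S \<subseteq> X" using S by (rule geodesically_convex_subset)
  fix x y z
  assume x: "x \<in> adherence S" and y: "y \<in> adherence S" and z: "z \<in> X" "d x z + d z y = d x y"
  have X: "x \<in> X" "y \<in> X" using x y by (auto simp: adherence_def)
  show "z \<in> adherence S"
    unfolding adherence_def
  proof (intro CollectI conjI allI impI z(1))
    fix e :: real assume "e > 0"
    define \<delta> where "\<delta> = e / 5"
    have \<delta>: "\<delta> > 0" using \<open>e > 0\<close> by (simp add: \<delta>_def)
    obtain x' where x': "x' \<in> S" "d x x' < \<delta>" using x \<delta> by (auto simp: adherence_def)
    obtain y' where y': "y' \<in> S" "d y y' < \<delta>" using y \<delta> by (auto simp: adherence_def)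
    have X': "x' \<in> X" "y' \<in> X" using x' y' SX by auto
    have xy': "d x y \<le> d x' y' + 2 * \<delta>" "d x' y' \<le> d x y + 2 * \<delta>"
      using triangle[OF X(1) X'(1) X(2)] triangle[OF X'(1,2) X(2)] triangle[OF X'(1) X(1) X'(2)]
        triangle[OF X X'(2)] x'(2) y'(2) commute[of x' x] commute[of y' y] by linarith+
    \<comment> \<open>The perturbed segment may be shorter than \<open>d x z\<close>, hence the
      truncation.\<close>
    define t where "t = min (d x z) (d x' y')"
    have t: "0 \<le> t" "t \<le> d x' y'" by (auto simp: t_def)
    then obtain w where w: "w \<in> X" "d x' w = t" "d w y' = d x' y' - t"
      using point_on_geodesic[OF X'] by blast
    have "w \<in> S" using geodesically_convexD[OF S x'(1) y'(1) w(1)] w by simp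
    moreover have "d w z \<le> max (d w x - d x z) (d w y - d z y)"
      by (rule four_point_segment) (use X z w in auto)
    moreover have "d w x \<le> t + \<delta>" "d w y \<le> d x' y' - t + \<delta>"
      using triangle[OF w(1) X'(1) X(1)] triangle[OF w(1) X'(2) X(2)] w x'(2) y'(2)
        commute[of w x'] commute[of x' x] commute[of y' y] by linarith+
    ultimately have "d z w < e"
      using xy' z(2) \<delta> commute[of z w] nonneg[of z y] unfolding t_def \<delta>_def by linarith
    with \<open>w \<in> S\<close> show "\<exists>w\<in>S. d z w < e" ..
  qed
qed

end

section \<open>Restriction to a closed subgroup and a closed subtree\<close>

context tree_action
begin

text \<open>Elements of \<open>BijGroup S\<close> are extensional, so the maps are cut off outside
  \<open>S\<close>. Surjectivity onto \<open>S\<close> follows from invariance under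
  inverses.\<close>

lemma group_action_restrict:
  assumes H: "subgroup H G" and SX: "S \<subseteq> X"
    and invar: "\<And>h x. h \<in> H \<Longrightarrow> x \<in> S \<Longrightarrow> \<phi> h x \<in> S"
  shows "group_action (G\<lparr>carrier := H\<rparr>) S (\<lambda>g. restrict (\<phi> g) S)"
proof -
  have HG: "H \<subseteq> carrier G" using H by (rule subgroup.subset)
  have Bij: "restrict (\<phi> g) S \<in> Bij S" if g: "g \<in> H" for g
  proof -
    have "inj_on (\<phi> g) S"
      by (rule inj_on_subset[OF group_action.inj_prop[OF group_action]]) (use g HG SX in auto)
    moreover have "\<phi> g ` S = S"
    proof
      show "S \<subseteq> \<phi> g ` S"
      proof
        fix x assume "x \<in> S"
        then have "x \<in> X" "g \<in> carrier G" "\<phi> (inv g) x \<in> S"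
          using g HG SX invar subgroup.m_inv_closed[OF H g] by auto
        then have "x = \<phi> g (\<phi> (inv g) x)" "\<phi> (inv g) x \<in> S" by simp_all
        then show "x \<in> \<phi> g ` S" by (rule image_eqI)
      qed
    qed (use invar g in auto)
    ultimately show ?thesis by (simp add: Bij_def bij_betw_def)
  qed
  have "restrict (\<phi> (g \<otimes> h)) S = compose S (restrict (\<phi> g) S) (restrict (\<phi> h) S)"
    if "g \<in> H" "h \<in> H" for g h
    using that HG SX invar by (intro ext) (auto simp: compose_def act_mult subset_iff)
  then have "(\<lambda>g. restrict (\<phi> g) S) \<in> hom (G\<lparr>carrier := H\<rparr>) (BijGroup S)"
    using Bij by (auto simp: hom_def BijGroup_def)
  then show ?thesis
    by (intro group_action.intro group_hom.intro group_hom_axioms.intro group_BijGroup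
        subgroup.subgroup_is_group[OF H] grp.group_axioms)
qed

lemma metric_group_subgroup:
  assumes H: "subgroup H G"
    and closed: "\<And>g. g \<in> carrier G \<Longrightarrow> (\<And>\<epsilon>. \<epsilon> > 0 \<Longrightarrow> \<exists>h\<in>H. dG g h < \<epsilon>) \<Longrightarrow> g \<in> H"
  shows "metric_group (G\<lparr>carrier := H\<rparr>) dG"
proof -
  have HG: "H \<subseteq> carrier G" using H by (rule subgroup.subset)
  interpret H: group "G\<lparr>carrier := H\<rparr>"
    by (rule subgroup.subgroup_is_group[OF H]) (rule grp.group_axioms)
  interpret HM: Metric_space H dG using HG by (rule grp.subspace)
  show ?thesis
  proof (intro metric_group.intro metric_group_axioms.intro)
    show "Metric_space.mcomplete (carrier (G\<lparr>carrier := H\<rparr>)) dG"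
      using grp.mcomplete_subspace[OF grp.complete HG closed] by simp
    show "\<exists>b. \<forall>x\<in>carrier (G\<lparr>carrier := H\<rparr>). \<forall>y\<in>carrier (G\<lparr>carrier := H\<rparr>). dG x y \<le> b"
      using grp.bounded HG by (auto simp: subset_iff) blast
  qed (use HG grp.left_invariant grp.right_invariant H.group_axioms HM.Metric_space_axioms
       in \<open>auto simp: subset_iff\<close>)
qed

text \<open>Closedness gives completeness of the group and of the balls, and convexity preserves
  segments. The predicates of \<open>N\<close> are then restrictions of the old ones, so the moduli,
  growth and coherence axioms carry over pointwise.\<close>

lemma restrict_tree_action:
  assumes H: "subgroup H G"
    and H_closed: "\<And>g. g \<in> carrier G \<Longrightarrow> (\<And>\<epsilon>. \<epsilon> > 0 \<Longrightarrow> \<exists>h\<in>H. dG g h < \<epsilon>) \<Longrightarrow> g \<in> H"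
    and S: "geodesically_convex S" and p: "p \<in> S"
    and S_closed: "\<And>x. x \<in> X \<Longrightarrow> (\<And>\<epsilon>. \<epsilon> > 0 \<Longrightarrow> \<exists>y\<in>S. d x y < \<epsilon>) \<Longrightarrow> x \<in> S"
    and invar: "\<And>h x. h \<in> H \<Longrightarrow> x \<in> S \<Longrightarrow> \<phi> h x \<in> S"
    and K: "struct \<in> K_isoR gth \<gamma>"
  defines "N \<equiv> action_structure (G\<lparr>carrier := H\<rparr>) dG S d p (\<lambda>g. restrict (\<phi> g) S)"
  shows "tree_action (G\<lparr>carrier := H\<rparr>) dG S d p (\<lambda>g. restrict (\<phi> g) S)"
    and "N \<in> K_isoR gth \<gamma>" and "substructure N struct"
    and "points N = Inl ` H \<union> Inr ` (SIGMA n:UNIV. S \<inter> mcball p (real n))"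
proof -
  have HG: "H \<subseteq> carrier G" using H by (rule subgroup.subset)
  have SX: "S \<subseteq> X" using S by (rule geodesically_convex_subset)
  interpret S: hyperbolic_tree S d by (rule hyperbolic_tree_convex[OF S])
  have ball: "S.mcball p r = S \<inter> mcball p r" for r
    using SX p base_point by auto
  have "Metric_space.mcomplete (S.mcball p (real n)) d" for n
  proof -
    interpret B: Metric_space "mcball p (real n)" d by (rule struct_metric_space)
    show ?thesis
      unfolding ball
    proof (rule B.mcomplete_subspace[OF complete_balls])
      fix x assume x: "x \<in> mcball p (real n)" "\<And>\<epsilon>. \<epsilon> > 0 \<Longrightarrow> \<exists>y\<in>S \<inter> mcball p (real n). d x y < \<epsilon>"
      then have "x \<in> S" by (intro S_closed) auto
      then show "x \<in> S \<inter> mcball p (real n)" using x by blast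
    qed auto
  qed
  then show action: "tree_action (G\<lparr>carrier := H\<rparr>) dG S d p (\<lambda>g. restrict (\<phi> g) S)"
    using metric_group_subgroup[OF H H_closed] group_action_restrict[OF H SX invar] HG SX p
    by (intro tree_action.intro S.hyperbolic_tree_axioms tree_action_axioms.intro)
      (auto simp: isometric_action_def subset_iff)
  interpret N: tree_action "G\<lparr>carrier := H\<rparr>" dG S d p "\<lambda>g. restrict (\<phi> g) S" by (rule action)
  have circ: "circ N m n g x y = circ struct m n g x y" if "g \<in> H" "x \<in> S" "y \<in> S" for m n g x y
  proof -
    have "segment S d (\<phi> g x) y = segment X d (\<phi> g x) y" "segment X d (\<phi> g x) y \<subseteq> S"
      using segment_convex segment_subset_convex S that invar by auto
    then show ?thesis
      using that unfolding N_def N.circ_struct circ_struct ball by (simp add: Int_assoc[symmetric] Int_absorb2)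
  qed
  have sel: "grp N = G\<lparr>carrier := H\<rparr>" "gdist N = dG" "bset N n = S \<inter> mcball p (real n)"
    "bdist N n = d" "base N n = p" "incl N m n x = x" for m n x
    by (simp_all add: N_def ball)
  have regular: "circ_regular \<gamma> struct" and growth: "circ_growth gth struct"
    and coherent: "circ_coherent gth struct"
    using K by (auto simp: K_isoR_def)
  have "circ_growth gth N"
    \<comment> \<open>Unfolding exposes the pointwise form; folding back lets \<open>circ\<close>
      compare the values with those of \<open>struct\<close>.\<close>
    unfolding N_def N.circ_growth_struct_iff unfolding N_def[symmetric] ball
  proof (intro ballI allI impI)
    fix \<delta> m n s g x
    assume "\<delta> \<in> {0..<1} \<inter> \<rat>" "m < n" "gth m \<delta> \<le> n" "n < s"
      and "g \<in> carrier (G\<lparr>carrier := H\<rparr>)" "x \<in> S \<inter> mcball p (real m)"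
    moreover from this have "g \<in> carrier G" using HG by auto
    ultimately show "min (circ N m s g x p \<dotminus> real n) (\<delta> \<dotminus> dG \<one>\<^bsub>G\<lparr>carrier := H\<rparr>\<^esub> g) = 0"
      using growth[unfolded circ_growth_struct_iff, rule_format, of \<delta> m n s g x] p
      by (simp add: circ)
  qed
  moreover have "circ_coherent gth N"
    unfolding N_def N.circ_coherent_struct_iff unfolding N_def[symmetric] ball
  proof (intro ballI allI impI)
    fix \<delta> m m' s t g x y
    assume "\<delta> \<in> {0..<1} \<inter> \<rat>" "m < m'" "m < s" "m' < t" "gth m \<delta> < s" "s < t" "gth m' \<delta> < t"
      and "g \<in> carrier (G\<lparr>carrier := H\<rparr>)" "x \<in> S \<inter> mcball p (real m)" "y \<in> S \<inter> mcball p (real m)"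
    moreover from this have "g \<in> carrier G" using HG by auto
    ultimately show "min \<bar>circ N m s g x y \<dotminus> circ N m' t g x y\<bar>
        (\<delta> \<dotminus> dG \<one>\<^bsub>G\<lparr>carrier := H\<rparr>\<^esub> g) = 0"
      using coherent[unfolded circ_coherent_struct_iff, rule_format, of \<delta> m m' s t g x y]
      by (simp add: circ)
  qed
  moreover have "circ_regular \<gamma> N"
    unfolding circ_regular_def sel
  proof (intro conjI allI impI ballI)
    note reg = regular[unfolded circ_regular_def struct_sel]
    note in_range = conjunct1[OF reg, rule_format]
      and modulus_G = conjunct1[OF conjunct2[OF reg], rule_format]
      and modulus_B = conjunct2[OF conjunct2[OF reg], rule_format]
    fix m n
    show "circ N m n g x y \<in> {0..real m + real n}"
      if "m \<le> n" "g \<in> carrier (G\<lparr>carrier := H\<rparr>)" "x \<in> S \<inter> mcball p (real m)"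
        "y \<in> S \<inter> mcball p (real m)" for g x y
      using in_range[of m n g x y] that HG by (auto simp: circ)
    show "has_modulus (carrier (G\<lparr>carrier := H\<rparr>)) dG (\<gamma> m n) (\<lambda>g. circ N m n g x y)"
      if "m < n" "x \<in> S \<inter> mcball p (real m)" "y \<in> S \<inter> mcball p (real m)" for x y
      by (rule has_modulus_subset[OF modulus_G[of m n x y]]) (use that HG in \<open>auto simp: circ\<close>)
    fix g z assume that: "m \<le> n" "g \<in> carrier (G\<lparr>carrier := H\<rparr>)" "z \<in> S \<inter> mcball p (real m)"
    show "has_modulus (S \<inter> mcball p (real m)) d id (\<lambda>x. circ N m n g x z)"
      by (rule has_modulus_subset[OF conjunct1[OF modulus_B[of m n g z]]])
        (use that HG in \<open>auto simp: circ\<close>)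
    show "has_modulus (S \<inter> mcball p (real m)) d id (\<lambda>y. circ N m n g z y)"
      by (rule has_modulus_subset[OF conjunct2[OF modulus_B[of m n g z]]])
        (use that HG in \<open>auto simp: circ\<close>)
  qed
  ultimately show "N \<in> K_isoR gth \<gamma>"
    unfolding N_def N.struct_in_K_isoR_iff by blast
  show points: "points N = Inl ` H \<union> Inr ` (SIGMA n:UNIV. S \<inter> mcball p (real n))"
    by (simp add: points_def sel)
  show "substructure N struct"
    unfolding substructure_def points
    using HG by (auto simp: sel circ points_def grp.m_inv_consistent[OF H])
qed

end

section \<open>Cardinalities\<close>

unbundle cardinal_syntax

lemma card_Un_le_infinite:
  "infinite B \<Longrightarrow> |A| \<le>o |B| \<Longrightarrow> |A'| \<le>o |B| \<Longrightarrow> |A \<union> A'| \<le>o |B|"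
  using card_of_Un_ordLeq_infinite_Field[of "|B|" A A', OF _ _ _ card_of_Card_order]
  by (simp add: Field_card_of)

lemma card_Times_le_infinite:
  "infinite B \<Longrightarrow> |A| \<le>o |B| \<Longrightarrow> |A'| \<le>o |B| \<Longrightarrow> |A \<times> A'| \<le>o |B|"
  using card_of_Times_ordLeq_infinite_Field[of "|B|" A A', OF _ _ _ card_of_Card_order]
  by (simp add: Field_card_of)

lemma card_image_le: "|A| \<le>o |B| \<Longrightarrow> |f ` A| \<le>o |B|"
  by (rule ordLeq_transitive[OF card_of_image])

lemma card_subset_le: "A \<subseteq> A' \<Longrightarrow> |A'| \<le>o |B| \<Longrightarrow> |A| \<le>o |B|"
  by (rule ordLeq_transitive[OF card_of_mono1])

lemma card_countable_le:
  assumes "infinite B" "countable A"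
  shows "|A| \<le>o |B|"
proof -
  have "|A| \<le>o |UNIV :: nat set|"
    using assms(2) unfolding countable_def by (subst card_of_ordLeq[symmetric]) simp
  also have "|UNIV :: nat set| \<le>o |B|"
    using assms(1) by (simp add: infinite_iff_card_of_nat)
  finally show ?thesis .
qed

text \<open>Countably many rounds of adjoining all quotients. No round exceeds the cardinality of
  \<open>B\<close>, because squares and countable unions do not enlarge an infinite
  cardinal.\<close>

lemma (in group) subgroup_of_small_card:
  assumes B: "infinite B" and A: "A \<subseteq> carrier G" "|A| \<le>o |B|"
  obtains H where "subgroup H G" "A \<subseteq> H" "|H| \<le>o |B|"
proof -
  define F where "F = rec_nat (insert \<one> A) (\<lambda>_ T. T \<union> (\<lambda>(a, b). a \<otimes> inv b) ` (T \<times> T))"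
  have F_0: "F 0 = insert \<one> A"
    and F_Suc: "F (Suc n) = F n \<union> (\<lambda>(a, b). a \<otimes> inv b) ` (F n \<times> F n)" for n
    by (simp_all add: F_def)
  have F_mono: "i \<le> j \<Longrightarrow> F i \<subseteq> F j" for i j
    by (rule lift_Suc_mono_le[of F]) (auto simp: F_Suc)
  have F_carrier: "F n \<subseteq> carrier G" for n
    using A(1) by (induction n) (auto simp: F_0 F_Suc)
  have F_card: "|F n| \<le>o |B|" for n
  proof (induction n)
    case 0
    have "|{\<one>} \<union> A| \<le>o |B|"
      by (rule card_Un_le_infinite[OF B card_countable_le[OF B] A(2)]) simp
    then show ?case by (simp add: F_0)
  next
    case (Suc n)
    then show ?case unfolding F_Suc
      using B by (intro card_Un_le_infinite card_image_le card_Times_le_infinite)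
  qed
  define H where "H = (\<Union>n. F n)"
  have diff: "a \<otimes> inv b \<in> H" if ab: "a \<in> H" "b \<in> H" for a b
  proof -
    obtain i j where "a \<in> F i" "b \<in> F j" using ab by (auto simp: H_def)
    then have "a \<in> F (max i j)" "b \<in> F (max i j)"
      using F_mono[of i "max i j"] F_mono[of j "max i j"] by auto
    then have "a \<otimes> inv b \<in> F (Suc (max i j))" by (auto simp: F_Suc)
    then show ?thesis by (auto simp: H_def)
  qed
  have HG: "H \<subseteq> carrier G" using F_carrier by (auto simp: H_def)
  have one: "\<one> \<in> H" using F_0 by (auto simp: H_def)
  have inv: "inv a \<in> H" if "a \<in> H" for a
    using diff[OF one that] that HG by (simp add: subset_iff)
  have "subgroup H G"
  proof (rule subgroupI)
    fix a b assume "a \<in> H" "b \<in> H"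
    then show "a \<otimes> b \<in> H"
      using diff[of a "inv b"] inv[of b] HG by (simp add: subset_iff)
  qed (use HG one inv in auto)
  moreover have "A \<subseteq> H" using F_0 by (auto simp: H_def)
  moreover have "|H| \<le>o |B|"
    unfolding H_def using B F_card by (intro card_of_UNION_ordLeq_infinite card_countable_le) auto
  ultimately show thesis by (rule that)
qed

section \<open>Closures of subgroups\<close>

lemma (in metric_group) inv_dist:
  assumes "g \<in> carrier G" "h \<in> carrier G"
  shows "d (inv g) (inv h) = d g h"
proof -
  \<comment> \<open>Multiplying by \<open>g\<close> on the left and by \<open>h\<close> on the right
    carries the pair of inverses to \<open>h\<close> and \<open>g\<close>.\<close>
  have "d (inv g) (inv h) = d (g \<otimes> inv g) (g \<otimes> inv h)"
    using left_invariant[of "inv g" "inv h" g] assms by simp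
  also have "\<dots> = d (g \<otimes> inv g \<otimes> h) (g \<otimes> inv h \<otimes> h)"
    using right_invariant[of "g \<otimes> inv g" "g \<otimes> inv h" h] assms by simp
  also have "\<dots> = d h g" using assms by (simp add: m_assoc)
  finally show ?thesis by (simp add: commute)
qed

text \<open>By bi-invariance inversion is an isometry, and the errors of two factors add up in their
  product.\<close>

lemma (in metric_group) subgroup_adherence:
  assumes H: "subgroup H G"
  shows "subgroup (adherence H) G"
  unfolding adherence_def
proof (rule subgroupI)
  let ?K = "{g \<in> carrier G. \<forall>\<epsilon>>0. \<exists>h\<in>H. d g h < \<epsilon>}" 
  have HG: "H \<subseteq> carrier G" using H by (rule subgroup.subset)
  have "\<one> \<in> ?K"
    using subgroup.one_closed[OF H] by (auto intro!: bexI[of _ \<one>])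
  then show "?K \<noteq> {}" by blast
  show "inv a \<in> ?K" if a: "a \<in> ?K" for a
  proof (intro CollectI conjI allI impI)
    fix \<epsilon> :: real assume "\<epsilon> > 0"
    then obtain h where "h \<in> H" "d a h < \<epsilon>" using a by auto
    then show "\<exists>h\<in>H. d (inv a) h < \<epsilon>"
      using a HG subgroup.m_inv_closed[OF H] inv_dist[of a h] by (intro bexI[of _ "inv h"]) auto
  qed (use a in auto)
  show "a \<otimes> b \<in> ?K" if a: "a \<in> ?K" and b: "b \<in> ?K" for a b
  proof (intro CollectI conjI allI impI)
    fix \<epsilon> :: real assume "\<epsilon> > 0"
    then have e: "\<epsilon> / 2 > 0" by simp
    obtain h where h: "h \<in> H" "d a h < \<epsilon> / 2" using a e by blast
    obtain k where k: "k \<in> H" "d b k < \<epsilon> / 2" using b e by blast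
    have G: "a \<in> carrier G" "b \<in> carrier G" "h \<in> carrier G" "k \<in> carrier G"
      using a b h k HG by auto
    have "d (a \<otimes> b) (h \<otimes> k) \<le> d (a \<otimes> b) (h \<otimes> b) + d (h \<otimes> b) (h \<otimes> k)"
      using G by (intro triangle) auto
    also have "\<dots> = d a h + d b k"
      using G left_invariant right_invariant by simp
    finally show "\<exists>h\<in>H. d (a \<otimes> b) h < \<epsilon>"
      using h k subgroup.m_closed[OF H h(1) k(1)] by (intro bexI[of _ "h \<otimes> k"]) auto
  qed (use a b in auto)
qed auto

section \<open>Stars of segments around a base point\<close>

context hyperbolic_tree
begin

text \<open>A point between \<open>x\<close> and \<open>y\<close> lies between \<open>p\<close> and
  \<open>x\<close> or between \<open>p\<close> and \<open>y\<close>, by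
  \<open>four_point_segment\<close>. It is therefore on the same ray segment as that
  endpoint.\<close>

lemma geodesically_convex_star:
  assumes p: "p \<in> X" and E: "E \<subseteq> X"
  shows "geodesically_convex (\<Union>e\<in>E. segment X d p e)"
  unfolding geodesically_convex_def
proof (intro conjI ballI impI)
  have star: "z \<in> (\<Union>e\<in>E. segment X d p e)"
    if z: "z \<in> X" and x: "x \<in> (\<Union>e\<in>E. segment X d p e)" and le: "d p z + d z x \<le> d p x" for x z
  proof -
    obtain e where e: "e \<in> E" "e \<in> X" "x \<in> X" "d p x + d x e = d p e"
      using x E p by (auto simp: segment_eq subset_iff)
    have "d z e \<le> d z x + d x e" "d p e \<le> d p z + d z e"
      using triangle z e p by auto
    then have "z \<in> segment X d p e"
      using e z p le by (auto simp: segment_eq)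
    then show ?thesis using e by blast
  qed
  show X: "(\<Union>e\<in>E. segment X d p e) \<subseteq> X"
    using E p by (auto simp: segment_eq subset_iff)
  fix x y z
  assume xy: "x \<in> (\<Union>e\<in>E. segment X d p e)" "y \<in> (\<Union>e\<in>E. segment X d p e)"
    and z: "z \<in> X" "d x z + d z y = d x y"
  have "x \<in> X" "y \<in> X" using xy X by auto
  then have "d p z \<le> max (d p x - d x z) (d p y - d z y)"
    using p z by (intro four_point_segment)
  then have "d p z + d z x \<le> d p x \<or> d p z + d z y \<le> d p y"
    using commute[of x z] by linarith
  then show "z \<in> (\<Union>e\<in>E. segment X d p e)"
    using star z(1) xy by blast
qed

text \<open>The points at rational distance from \<open>p\<close> on the segments suffice: two
  points of one segment are as far apart as their distances from \<open>p\<close> differ.\<close>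

lemma star_density:
  assumes p: "p \<in> X" and E: "E \<subseteq> X" "|E| \<le>o |B|" and B: "infinite B"
  obtains Q where "Q \<subseteq> X" "|Q| \<le>o |B|"
    "\<And>x \<epsilon>. x \<in> (\<Union>e\<in>E. segment X d p e) \<Longrightarrow> \<epsilon> > 0 \<Longrightarrow> \<exists>q\<in>Q. d x q < \<epsilon>"
proof -
  let ?P = "\<lambda>e r z. z \<in> X \<and> d p z = r \<and> d z e = d p e - r"
  define R where "R = {(e, r) \<in> E \<times> \<rat>. 0 \<le> r \<and> r \<le> d p e}"
  define f where "f = (\<lambda>(e, r). SOME z. ?P e r z)"
  have f: "?P e r (f (e, r))" if "(e, r) \<in> R" for e r
  proof -
    have "\<exists>z. ?P e r z"
      using that p E point_on_geodesic[of p e r] unfolding R_def by auto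
    then show ?thesis unfolding f_def by (simp only: case_prod_conv) (rule someI_ex)
  qed
  show thesis
  proof
    show "f ` R \<subseteq> X" using f by auto
    have "|E \<times> (\<rat>::real set)| \<le>o |B|"
      by (rule card_Times_le_infinite[OF B E(2) card_countable_le[OF B countable_rat]])
    then show "|f ` R| \<le>o |B|"
      by (intro card_image_le) (rule card_subset_le[rotated], auto simp: R_def)
  next
    fix x and \<epsilon> :: real assume "x \<in> (\<Union>e\<in>E. segment X d p e)" and "\<epsilon> > 0"
    then obtain e where e: "e \<in> E" "e \<in> X" and x: "x \<in> X" "d p x + d x e = d p e"
      using E p by (auto simp: segment_eq subset_iff)
    obtain r where r: "r \<in> \<rat>" "0 \<le> r" "r \<le> d p x" "d p x - r < \<epsilon>"
    proof (cases "d p x = 0")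
      case True
      then show ?thesis using that[of 0] \<open>\<epsilon> > 0\<close> by simp
    next
      case False
      then have "max 0 (d p x - \<epsilon>) < d p x" using \<open>\<epsilon> > 0\<close> nonneg[of p x] by linarith
      then obtain r where "r \<in> \<rat>" "max 0 (d p x - \<epsilon>) < r" "r < d p x"
        using Rats_dense_in_real by blast
      then show ?thesis using that[of r] by simp
    qed
    have eR: "(e, r) \<in> R" using e r x nonneg[of x e] by (auto simp: R_def simp del: nonneg)
    let ?q = "f (e, r)"
    have "d ?q x \<le> max (d ?q p - d p x) (d ?q e - d x e)"
      using f[OF eR] x e p by (intro four_point_segment) auto
    then have "d x ?q < \<epsilon>"
      using f[OF eR] r x commute[of ?q p] commute[of ?q x] \<open>\<epsilon> > 0\<close> by linarith
    then show "\<exists>q\<in>f ` R. d x q < \<epsilon>" using eR by blast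
  qed
qed

end

section \<open>Density characters\<close>

lemma close_mono: "close M \<epsilon> a b \<Longrightarrow> \<epsilon> \<le> \<epsilon>' \<Longrightarrow> close M \<epsilon>' a b"
  by (cases "(M, \<epsilon>, a, b)" rule: close.cases) auto

lemma close_cong:
  assumes "gdist M = gdist N" "bdist M = bdist N"
  shows "close M = close N"
proof (intro ext)
  show "close M \<epsilon> a b = close N \<epsilon> a b" for \<epsilon> a b
    using assms by (cases "(M, \<epsilon>, a, b)" rule: close.cases) auto
qed

text \<open>A set \<open>D\<close> that approximates \<open>S\<close> need not lie in
  \<open>S\<close>. For each \<open>b\<close> in \<open>D\<close> and each \<open>k\<close>, a point
  of \<open>S\<close> within \<open>1 / (k + 1)\<close> of \<open>b\<close> is chosen if there is
  one; this costs only a countable factor.\<close>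

lemma dense_subset_of_approximation:
  assumes B: "infinite B" and D: "|D| \<le>o |B|"
    and approx: "\<And>a \<epsilon>. a \<in> S \<Longrightarrow> \<epsilon> > 0 \<Longrightarrow> \<exists>b\<in>D. close M \<epsilon> a b"
    and triangle: "\<And>a a' b \<epsilon>. \<lbrakk>a \<in> S; a' \<in> S; b \<in> D; close M \<epsilon> a b; close M \<epsilon> a' b\<rbrakk>
      \<Longrightarrow> close M (2 * \<epsilon>) a a'"
  obtains E where "dense_subset M S E" "|E| \<le>o |B|"
proof
  let ?P = "\<lambda>b k a. a \<in> S \<and> close M (1 / real (Suc k)) a b"
  define R where "R = {(b, k) \<in> D \<times> UNIV. \<exists>a. ?P b k a}"
  define f where "f = (\<lambda>(b, k). SOME a. ?P b k a)"
  have f: "?P b k (f (b, k))" if "(b, k) \<in> R" for b k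
    using that someI_ex[of "?P b k"] unfolding R_def f_def by auto
  show "|f ` R| \<le>o |B|"
  proof (rule card_image_le, rule card_subset_le)
    show "R \<subseteq> D \<times> UNIV" by (auto simp: R_def)
    show "|D \<times> (UNIV :: nat set)| \<le>o |B|"
      by (rule card_Times_le_infinite[OF B D card_countable_le[OF B]]) simp
  qed
  show "dense_subset M S (f ` R)"
    unfolding dense_subset_def
  proof (intro conjI ballI allI impI)
    show "f ` R \<subseteq> S" using f by auto
    fix a and \<epsilon> :: real assume a: "a \<in> S" and "\<epsilon> > 0"
    then obtain k where k: "1 / real (Suc k) < \<epsilon> / 2"
      using nat_approx_posE[of "\<epsilon> / 2"] by auto
    obtain b where b: "b \<in> D" "close M (1 / real (Suc k)) a b"
      using approx[OF a, of "1 / real (Suc k)"] by auto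
    then have R: "(b, k) \<in> R" using a by (auto simp: R_def)
    have "close M (2 * (1 / real (Suc k))) a (f (b, k))"
      using triangle[OF a _ b(1,2)] f[OF R] by blast
    then have "close M \<epsilon> a (f (b, k))" by (rule close_mono) (use k in simp)
    then show "\<exists>b\<in>f ` R. close M \<epsilon> a b" using R by blast
  qed
qed

text \<open>Cardinals are well-ordered, so among the dense subsets, of which \<open>S\<close> itself
  is one, some have least cardinality and the choice in the definition is not vacuous.\<close>

lemma density_character_attained:
  assumes "\<And>a \<epsilon>. a \<in> S \<Longrightarrow> \<epsilon> > 0 \<Longrightarrow> close M \<epsilon> a a"
  obtains D where "density_character M S = |D|" "dense_subset M S D"
    "\<And>E. dense_subset M S E \<Longrightarrow> |D| \<le>o |E|"
proof -
  let ?P = "\<lambda>D. dense_subset M S D \<and> (\<forall>E. dense_subset M S E \<longrightarrow> |D| \<le>o |E| )"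
  have "dense_subset M S S" using assms by (auto simp: dense_subset_def)
  then have "card_of ` Collect (dense_subset M S) \<noteq> {}" by blast
  from exists_minim_Card_order[OF this] have "\<exists>D. ?P D" by (auto simp: card_of_Card_order)
  then have "?P (SOME D. ?P D)" by (rule someI_ex)
  then show thesis using that by (auto simp: density_character_def)
qed

text \<open>A point of \<open>S\<close> outside a finite \<open>D\<close> is kept away from all of
  \<open>D\<close> by one positive radius, so a finite dense \<open>D\<close> would be all of
  \<open>S\<close>.\<close>

lemma infinite_dense_subset:
  assumes dense: "dense_subset M S D" and "infinite S"
    and separated: "\<And>a b. a \<in> S \<Longrightarrow> b \<in> S \<Longrightarrow> (\<And>\<epsilon>. \<epsilon> > 0 \<Longrightarrow> close M \<epsilon> a b) \<Longrightarrow> a = b"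
  shows "infinite D"
proof
  assume fin: "finite D"
  have "a \<in> D" if a: "a \<in> S" for a
  proof (rule ccontr)
    assume "a \<notin> D"
    then have "\<forall>b\<in>D. \<exists>\<epsilon>>0. \<not> close M \<epsilon> a b"
      using a separated dense unfolding dense_subset_def by blast
    then obtain e where e: "\<And>b. b \<in> D \<Longrightarrow> e b > 0" "\<And>b. b \<in> D \<Longrightarrow> \<not> close M (e b) a b"
      by metis
    \<comment> \<open>The inserted 1 keeps the minimum defined when \<open>D\<close> is
      empty.\<close>
    define m where "m = Min (insert (1::real) (e ` D))"
    have "m > 0" unfolding m_def using fin e(1) by (subst Min_gr_iff) auto
    then obtain b where b: "b \<in> D" "close M m a b"
      using dense a unfolding dense_subset_def by blast
    have "m \<le> e b" unfolding m_def using fin b by (intro Min_le) auto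
    then show False using close_mono[OF b(2)] e(2)[OF b(1)] by blast
  qed
  then have "S \<subseteq> D" ..
  then show False using fin \<open>infinite S\<close> by (simp add: finite_subset)
qed

section \<open>Closeness in action structures and the small witness\<close>

context tree_action
begin

lemma points_struct: "points struct = Inl ` carrier G \<union> Inr ` (SIGMA n:UNIV. mcball p (real n))"
  by (simp add: points_def)

lemma close_struct_triangle:
  assumes "{a, a', b} \<subseteq> Inl ` carrier G \<union> Inr ` (UNIV \<times> X)"
    and "close struct \<epsilon> a b" "close struct \<epsilon> a' b"
  shows "close struct (2 * \<epsilon>) a a'"
proof (cases b)
  case (Inl h)
  obtain g g' where "a = Inl g" "a' = Inl g'"
    using assms(2,3) unfolding Inl by (cases a; cases a') auto
  then show ?thesis
    using assms Inl grp.triangle'[of g h g'] by auto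
next
  case (Inr z)
  obtain n y where "z = (n, y)" by (cases z)
  moreover obtain m x m' x' where "a = Inr (m, x)" "a' = Inr (m', x')"
    using assms(2,3) unfolding Inr by (cases a; cases a') auto
  ultimately show ?thesis
    using assms Inr triangle'[of x y x'] by auto
qed

lemma close_struct_refl: "a \<in> points struct \<Longrightarrow> \<epsilon> > 0 \<Longrightarrow> close struct \<epsilon> a a"
  by (auto simp: points_struct)

lemma close_struct_separated:
  assumes "a \<in> points struct" "b \<in> points struct" and close: "\<And>\<epsilon>. \<epsilon> > 0 \<Longrightarrow> close struct \<epsilon> a b"
  shows "a = b"
proof -
  consider g h where "a = Inl g" "b = Inl h" "g \<in> carrier G" "h \<in> carrier G"
    | n x y where "a = Inr (n, x)" "b = Inr (n, y)" "x \<in> X" "y \<in> X"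
    using assms(1,2) close[of 1] by (auto simp: points_struct)
  then show ?thesis
  proof cases
    case 1
    then show ?thesis using close[of "dG g h"] grp.mdist_pos_less[of g h] by auto
  next
    case 2
    then show ?thesis using close[of "d x y"] mdist_pos_less[of x y] by auto
  qed
qed

lemma witness_of_small_density:
  assumes \<gamma>: "\<And>m n \<epsilon>. m < n \<Longrightarrow> \<epsilon> > 0 \<Longrightarrow> \<gamma> m n \<epsilon> > 0"
    and K: "struct \<in> K_isoR gth \<gamma>"
    and no_fix: "\<not> (\<exists>c\<in>X. \<forall>g\<in>carrier G. \<phi> g c = c)"
    and C: "C \<subseteq> points struct" "infinite C"
  shows "\<exists>N\<in>nonFR_structures gth \<gamma>. substructure N struct \<and> C \<subseteq> points N \<and>
    density_character N (points N) =o density_character struct C"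
proof -
  obtain D where D: "density_character struct C = |D|" "dense_subset struct C D"
    and D_min: "\<And>E. dense_subset struct C E \<Longrightarrow> |D| \<le>o |E|"
  proof (rule density_character_attained[of C struct])
    show "close struct \<epsilon> a a" if "a \<in> C" "\<epsilon> > 0" for a \<epsilon>
      using that C(1) close_struct_refl by auto
  qed (rule that)
  have D_inf: "infinite D"
    using infinite_dense_subset[OF D(2) C(2)] close_struct_separated C(1) by blast
  have DC: "D \<subseteq> C" using D(2) by (simp add: dense_subset_def)
  define AG where "AG = {g. Inl g \<in> D}"
  \<comment> \<open>Levels are forgotten, since the ball sorts of the new structure are all cut out
    of a single subtree.\<close>
  define AX where "AX = {x. \<exists>n. Inr (n, x) \<in> D}"
  have AG: "AG \<subseteq> carrier G" and AX: "AX \<subseteq> X"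
    using DC C(1) by (auto simp: AG_def AX_def points_struct)
  have "|AG| \<le>o |D|"
    by (rule card_subset_le[of _ "projl ` D"]) (force simp: AG_def, simp add: card_of_image)
  moreover have AX_card: "|AX| \<le>o |D|"
    by (rule card_subset_le[of _ "(snd \<circ> projr) ` D"]) (force simp: AX_def, simp add: card_of_image)
  \<comment> \<open>Without a fixed point the orbit of \<open>p\<close> is unbounded; countably many
    elements record this inside the small subgroup.\<close>
  moreover have "\<exists>g\<in>carrier G. real k < d p (\<phi> g p)" for k
    using fixed_point_of_bounded_orbit[OF base_point, of "real k"] no_fix by force
  then obtain \<sigma> where \<sigma>: "\<And>k. \<sigma> k \<in> carrier G" "\<And>k. real k < d p (\<phi> (\<sigma> k) p)"
    by metis
  ultimately have "|AG \<union> range \<sigma>| \<le>o |D|"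
    using D_inf by (intro card_Un_le_infinite card_countable_le[of D "range \<sigma>"]) auto
  then obtain H0 where H0: "subgroup H0 G" "AG \<union> range \<sigma> \<subseteq> H0" "|H0| \<le>o |D|"
    using grp.subgroup_of_small_card[OF D_inf, of "AG \<union> range \<sigma>"] AG \<sigma>(1) by auto
  have H0G: "H0 \<subseteq> carrier G" using H0(1) by (rule subgroup.subset)
  \<comment> \<open>Metric groups are complete, hence the closure. \<open>H\<close> may be larger
    than \<open>D\<close>, but \<open>H0\<close> is dense in it.\<close>
  define H where "H = grp.adherence H0"
  have H: "subgroup H G" unfolding H_def by (rule grp.subgroup_adherence[OF H0(1)])
  have HG: "H \<subseteq> carrier G" using H by (rule subgroup.subset)
  have H0H: "H0 \<subseteq> H" unfolding H_def by (rule grp.subset_adherence[OF H0G])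
  \<comment> \<open>Including the orbit of \<open>p\<close> lets the convex star over
    \<open>E\<close> contain the translates of its own segments.\<close>
  define E where "E = (\<lambda>(h, x). \<phi> h x) ` (H0 \<times> insert p AX)"
  have E: "E \<subseteq> X" using H0G AX base_point by (auto simp: E_def subset_iff)
  have "|{p} \<union> AX| \<le>o |D|"
    by (rule card_Un_le_infinite[OF D_inf card_countable_le[OF D_inf] AX_card]) simp
  then have E_card: "|E| \<le>o |D|"
    unfolding E_def using H0(3) D_inf by (intro card_image_le card_Times_le_infinite) auto
  have act_E: "\<phi> h e \<in> E" if h: "h \<in> H0" and e: "e \<in> E" for h e
  proof -
    obtain k x where "k \<in> H0" "x \<in> insert p AX" "e = \<phi> k x" using e by (auto simp: E_def)
    moreover from this have "x \<in> X" "h \<in> carrier G" "k \<in> carrier G"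
      using h H0G AX base_point by auto
    moreover from this have "\<phi> h (\<phi> k x) = \<phi> (h \<otimes> k) x" by (simp add: act_mult)
    ultimately show ?thesis
      unfolding E_def using subgroup.m_closed[OF H0(1) h] 
      by (intro image_eqI[of _ _ "(h \<otimes> k, x)"]) auto
  qed
  have AX_E: "insert p AX \<subseteq> E"
  proof
    fix x assume x: "x \<in> insert p AX"
    then have "x = \<phi> \<one> x" using AX base_point by auto
    then show "x \<in> E"
      unfolding E_def using x subgroup.one_closed[OF H0(1)] by (intro image_eqI[of _ _ "(\<one>, x)"]) auto
  qed
  define Y where "Y = (\<Union>e\<in>E. segment X d p e)"
  have Y: "geodesically_convex Y"
    unfolding Y_def by (rule geodesically_convex_star[OF base_point E])
  have YX: "Y \<subseteq> X" using Y by (rule geodesically_convex_subset)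
  have EY: "E \<subseteq> Y"
  proof
    fix e assume "e \<in> E"
    moreover from this have "e \<in> segment X d p e" using E base_point by (auto simp: segment_eq)
    ultimately show "e \<in> Y" unfolding Y_def by blast
  qed
  have act_Y: "\<phi> h x \<in> Y" if h: "h \<in> H0" and x: "x \<in> Y" for h x
  proof -
    obtain e where e: "e \<in> E" "e \<in> X" "x \<in> X" "d p x + d x e = d p e"
      using x E base_point by (auto simp: Y_def segment_eq subset_iff)
    have hG: "h \<in> carrier G" using h H0G by auto
    show ?thesis
    \<comment> \<open>The isometry \<open>h\<close> carries the segment from \<open>p\<close> to
      \<open>e\<close> onto one whose endpoints are again in \<open>E\<close>, and convexity of
      \<open>Y\<close> does the rest.\<close>
    proof (rule geodesically_convexD[OF Y])
      show "\<phi> h p \<in> Y" "\<phi> h e \<in> Y" using act_E h e AX_E EY by auto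
    qed (use hG e base_point in auto)
  qed
  obtain Q where Q: "Q \<subseteq> X" "|Q| \<le>o |D|"
    and Q_dense: "\<And>x \<epsilon>. x \<in> Y \<Longrightarrow> \<epsilon> > 0 \<Longrightarrow> \<exists>q\<in>Q. d x q < \<epsilon>"
    using star_density[OF base_point E E_card D_inf] unfolding Y_def by blast
  define S where "S = adherence Y"
  have S: "geodesically_convex S" unfolding S_def by (rule geodesically_convex_adherence[OF Y])
  have SX: "S \<subseteq> X" using S by (rule geodesically_convex_subset)
  have YS: "Y \<subseteq> S" unfolding S_def by (rule subset_adherence[OF YX])
  have S_closed: "x \<in> S" if "x \<in> X" "\<And>\<epsilon>. \<epsilon> > 0 \<Longrightarrow> \<exists>y\<in>S. d x y < \<epsilon>" for x
    unfolding S_def by (rule adherence_closed[OF YX]) (use that in \<open>auto simp: S_def\<close>)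
  have H_closed: "g \<in> H" if "g \<in> carrier G" "\<And>\<epsilon>. \<epsilon> > 0 \<Longrightarrow> \<exists>h\<in>H. dG g h < \<epsilon>" for g
    unfolding H_def by (rule grp.adherence_closed[OF H0G]) (use that in \<open>auto simp: H_def\<close>)
  have pS: "p \<in> S" using AX_E EY YS by auto
  have act_H0_S: "\<phi> h x \<in> S" if h: "h \<in> H0" and x: "x \<in> S" for h x
  proof (rule S_closed)
    have hG: "h \<in> carrier G" using h H0G by auto
    show "\<phi> h x \<in> X" using hG x SX by auto
    fix \<epsilon> :: real assume "\<epsilon> > 0"
    then obtain y where y: "y \<in> Y" "d x y < \<epsilon>" using x by (auto simp: S_def adherence_def)
    moreover have "x \<in> X" "y \<in> X" using x y(1) SX YX by auto
    ultimately have "d (\<phi> h x) (\<phi> h y) < \<epsilon>" using hG by simp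
    then show "\<exists>y\<in>S. d (\<phi> h x) y < \<epsilon>" using act_Y[OF h y(1)] YS by blast
  qed
  have act_S: "\<phi> h x \<in> S" if h: "h \<in> H" and x: "x \<in> S" for h x
  proof (rule S_closed)
    have hG: "h \<in> carrier G" "x \<in> X" using h HG x SX by auto
    then show "\<phi> h x \<in> X" by simp
    fix \<epsilon> :: real assume "\<epsilon> > 0"
    have regular: "circ_regular \<gamma> struct" using K by (simp add: K_isoR_def)
    have "\<exists>\<delta>>0. \<forall>k\<in>carrier G. dG h k < \<delta> \<longrightarrow> d (\<phi> h x) (\<phi> k x) < \<epsilon>"
      by (rule act_continuous[OF regular _ hG \<open>\<epsilon> > 0\<close>]) (rule \<gamma>)
    then obtain \<delta> where \<delta>: "\<delta> > 0"
      "\<And>k. k \<in> carrier G \<Longrightarrow> dG h k < \<delta> \<Longrightarrow> d (\<phi> h x) (\<phi> k x) < \<epsilon>"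
      by blast
    obtain k where k: "k \<in> H0" "dG h k < \<delta>"
      using h \<delta>(1) unfolding H_def grp.adherence_def by blast
    then have "d (\<phi> h x) (\<phi> k x) < \<epsilon>" using \<delta>(2) H0G by blast
    then show "\<exists>y\<in>S. d (\<phi> h x) y < \<epsilon>" using act_H0_S[OF k(1) x] by blast
  qed
  define N where "N = action_structure (G\<lparr>carrier := H\<rparr>) dG S d p (\<lambda>g. restrict (\<phi> g) S)"
  note restriction = restrict_tree_action[OF H H_closed S pS S_closed act_S K, folded N_def]
  interpret N: tree_action "G\<lparr>carrier := H\<rparr>" dG S d p "\<lambda>g. restrict (\<phi> g) S"
    by (rule restriction(1); blast)
  have N_K: "N \<in> K_isoR gth \<gamma>" by (rule restriction(2); blast)
  have N_sub: "substructure N struct" by (rule restriction(3); blast)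
  have points_N_eq: "points N = Inl ` H \<union> Inr ` (SIGMA n:UNIV. S \<inter> mcball p (real n))"
    by (rule restriction(4); blast)
  have N_no_fix: "\<not> (\<exists>c\<in>S. \<forall>g\<in>carrier (G\<lparr>carrier := H\<rparr>). restrict (\<phi> g) S c = c)"
  proof
    assume "\<exists>c\<in>S. \<forall>g\<in>carrier (G\<lparr>carrier := H\<rparr>). restrict (\<phi> g) S c = c"
    then obtain c where c: "c \<in> S" "\<And>g. g \<in> H \<Longrightarrow> \<phi> g c = c" by auto
    \<comment> \<open>A fixed point \<open>c\<close> bounds every displacement of \<open>p\<close>
      by \<open>2 * d p c\<close>, which the element \<open>\<sigma> k\<close> violates.\<close>
    obtain k :: nat where k: "2 * d p c < real k" using reals_Archimedean2 by blast
    have "\<phi> (\<sigma> k) c = c" using c(2) H0(2) H0H by blast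
    then have "d c (\<phi> (\<sigma> k) p) = d c p" using act_dist[OF \<sigma>(1), of c p k] c(1) SX base_point by auto
    moreover have "d p (\<phi> (\<sigma> k) p) \<le> d p c + d c (\<phi> (\<sigma> k) p)"
      using c(1) SX base_point \<sigma>(1) by (intro triangle) auto
    ultimately show False using k \<sigma>(2)[of k] commute[of c p] by linarith
  qed
  have "nonFR_witness gth \<gamma> (G\<lparr>carrier := H\<rparr>) dG S d p (\<lambda>g. restrict (\<phi> g) S)"
    unfolding nonFR_witness_def N_def[symmetric]
    using N.grp.metric_group_axioms N.R_tree_axioms N.action N_no_fix pS N_K by blast
  then have N_in: "N \<in> nonFR_structures gth \<gamma>"
    unfolding nonFR_structures_def N_def by blast
  have C_N: "C \<subseteq> points N"
  proof
    fix a assume a: "a \<in> C"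
    have approx: "\<exists>b\<in>D. close struct \<epsilon> a b" if "\<epsilon> > 0" for \<epsilon>
      using D(2) a that unfolding dense_subset_def by blast
    consider g where "a = Inl g" "g \<in> carrier G" | n x where "a = Inr (n, x)" "x \<in> mcball p (real n)"
      using a C(1) by (auto simp: points_struct)
    then show "a \<in> points N"
    proof cases
      case 1
      have "g \<in> H"
      proof (rule H_closed[OF 1(2)])
        fix \<epsilon> :: real assume "\<epsilon> > 0"
        then obtain b where "b \<in> D" "close struct \<epsilon> a b" using approx by blast
        then obtain h where "h \<in> AG" "dG g h < \<epsilon>" unfolding AG_def 1 by (cases b) auto
        then show "\<exists>h\<in>H. dG g h < \<epsilon>" using H0(2) H0H by blast
      qed
      then show ?thesis unfolding points_N_eq 1 by simp
    next
      case 2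
      have "x \<in> S"
      proof (rule S_closed)
        fix \<epsilon> :: real assume "\<epsilon> > 0"
        then obtain b where "b \<in> D" "close struct \<epsilon> a b" using approx by blast
        moreover from this obtain y where "b = Inr (n, y)" "d x y < \<epsilon>"
          unfolding 2 by (cases b) auto
        ultimately have "y \<in> AX" "d x y < \<epsilon>" by (auto simp: AX_def)
        then show "\<exists>y\<in>S. d x y < \<epsilon>" using AX_E EY YS by blast
      qed (use 2 in auto)
      then show ?thesis unfolding points_N_eq 2 using 2(2) by blast
    qed
  qed
  have points_N: "points N \<subseteq> points struct" using N_sub by (simp add: substructure_def)
  have close_N: "close N = close struct"
    by (rule close_cong) (auto simp: N_def action_structure_def)
  have dense_N: "dense_subset N = dense_subset struct"
    by (intro ext) (simp add: dense_subset_def close_N)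
  have U: "points struct \<subseteq> Inl ` carrier G \<union> Inr ` (UNIV \<times> X)"
    by (auto simp: points_struct)
  obtain DN where DN: "density_character N (points N) = |DN|" "dense_subset struct (points N) DN"
    and DN_min: "\<And>E. dense_subset struct (points N) E \<Longrightarrow> |DN| \<le>o |E|"
  proof (rule density_character_attained[of "points N" N])
    show "close N \<epsilon> a a" if "a \<in> points N" "\<epsilon> > 0" for a \<epsilon>
      using that points_N close_struct_refl by (auto simp: close_N)
  qed (use that in \<open>simp add: dense_N\<close>)
  have DN_points: "DN \<subseteq> points N" using DN(2) by (simp add: dense_subset_def)
  have "infinite (points N)" using C(2) C_N by (rule infinite_super[rotated])
  then have DN_inf: "infinite DN"
    using infinite_dense_subset[OF DN(2)] close_struct_separated points_N by blast
  have "|DN| \<le>o |D|"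
  proof -
    \<comment> \<open>This set approximates the points of \<open>N\<close> but may leave them, as
      \<open>Q\<close> need not respect the balls or the subtree;
      \<open>dense_subset_of_approximation\<close> pulls it back.\<close>
    let ?T = "Inl ` H0 \<union> Inr ` ((UNIV :: nat set) \<times> Q)"
    have T_card: "|?T| \<le>o |D|"
      using D_inf H0(3) Q(2)
      by (intro card_Un_le_infinite card_image_le card_Times_le_infinite
          card_countable_le[of D "UNIV :: nat set"]) auto
    have T_U: "?T \<subseteq> Inl ` carrier G \<union> Inr ` (UNIV \<times> X)" using H0G Q(1) by auto
    obtain F where "dense_subset struct (points N) F" "|F| \<le>o |D|"
    proof (rule dense_subset_of_approximation[OF D_inf T_card])
      fix a and \<epsilon> :: real assume a: "a \<in> points N" and "\<epsilon> > 0"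
      consider g where "a = Inl g" "g \<in> H" | n x where "a = Inr (n, x)" "x \<in> S"
        using a by (auto simp: points_N_eq)
      then show "\<exists>b\<in>?T. close struct \<epsilon> a b"
      proof cases
        case 1
        then obtain h where "h \<in> H0" "dG g h < \<epsilon>"
          using \<open>\<epsilon> > 0\<close> by (auto simp: H_def grp.adherence_def)
        then show ?thesis using 1 by (intro bexI[of _ "Inl h"]) auto
      next
        case 2
        then obtain y where y: "y \<in> Y" "d x y < \<epsilon> / 2"
          using half_gt_zero[OF \<open>\<epsilon> > 0\<close>] unfolding S_def adherence_def by blast
        then obtain q where q: "q \<in> Q" "d y q < \<epsilon> / 2"
          using Q_dense half_gt_zero[OF \<open>\<epsilon> > 0\<close>] by blast
        have "d x q \<le> d x y + d y q" using 2 y q SX YX Q(1) by (intro triangle) auto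
        then have "d x q < \<epsilon>" using y q by linarith
        then show ?thesis using 2 q by (intro bexI[of _ "Inr (n, q)"]) auto
      qed
    next
      fix a a' b \<epsilon> assume "a \<in> points N" "a' \<in> points N" "b \<in> ?T"
        "close struct \<epsilon> a b" "close struct \<epsilon> a' b"
      moreover from this have "{a, a', b} \<subseteq> Inl ` carrier G \<union> Inr ` (UNIV \<times> X)"
        using points_N U T_U by blast
      ultimately show "close struct (2 * \<epsilon>) a a'" by (intro close_struct_triangle)
    qed (rule that)
    then show ?thesis using DN_min ordLeq_transitive by blast
  qed
  moreover have "|D| \<le>o |DN|"
  proof -
    \<comment> \<open>Passing to the subset \<open>C\<close> does not raise the density:
      \<open>DN\<close> approximates \<open>C\<close> from outside and is pulled back into
      it.\<close>
    obtain F where "dense_subset struct C F" "|F| \<le>o |DN|"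
    proof (rule dense_subset_of_approximation[OF DN_inf ordLeq_refl[OF card_of_Card_order]])
      show "\<exists>b\<in>DN. close struct \<epsilon> a b" if "a \<in> C" "\<epsilon> > 0" for a \<epsilon>
        using that C_N DN(2) unfolding dense_subset_def by blast
      fix a a' b \<epsilon> assume "a \<in> C" "a' \<in> C" "b \<in> DN"
        "close struct \<epsilon> a b" "close struct \<epsilon> a' b"
      moreover from this have "{a, a', b} \<subseteq> Inl ` carrier G \<union> Inr ` (UNIV \<times> X)"
        using C(1) DN_points points_N U by blast
      ultimately show "close struct (2 * \<epsilon>) a a'" by (intro close_struct_triangle)
    qed (rule that)
    then show ?thesis using D_min ordLeq_transitive by blast
  qed
  ultimately have "density_character N (points N) =o density_character struct C"
    unfolding DN(1) D(1) by (simp add: ordIso_iff_ordLeq)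
  then show ?thesis using N_in N_sub C_N by blast
qed

end

theorem theorem3p15:
  fixes gth :: "nat \<Rightarrow> real \<Rightarrow> nat" and \<gamma> :: "nat \<Rightarrow> nat \<Rightarrow> real \<Rightarrow> real"
  assumes "\<And>\<delta>. \<delta> \<in> {0..<1} \<Longrightarrow> mono (\<lambda>m. gth m \<delta>)"
    and "\<And>m n \<epsilon>. m < n \<Longrightarrow> \<epsilon> > 0 \<Longrightarrow> \<gamma> m n \<epsilon> > 0"
  shows "(\<exists>s::nat. s \<ge> 1 \<and>
            (\<forall>(G :: 'g monoid) dG. nonFR TYPE('x) gth \<gamma> G dG \<longrightarrow>
               (\<exists>(X :: 'x set) d p \<phi>. R_tree X d \<and> isometric_action G X d \<phi> \<and> p \<in> X \<and>
                  action_structure G dG X d p \<phi> \<in>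
                    {M \<in> K_isoR gth \<gamma>. \<forall>m n. m < n \<longrightarrow> Theta s m n M}))) \<and>
         bountiful (nonFR_structures gth \<gamma> :: ('g, 'x) ball_structure set)"
proof (intro conjI)
  have "\<exists>(X :: 'x set) d p \<phi>. R_tree X d \<and> isometric_action G X d \<phi> \<and> p \<in> X \<and>
      action_structure G dG X d p \<phi> \<in> {M \<in> K_isoR gth \<gamma>. \<forall>m n. m < n \<longrightarrow> Theta 1 m n M}"
    if "nonFR TYPE('x) gth \<gamma> G dG" for G :: "'g monoid" and dG
  proof -
    from that obtain X :: "'x set" and d p \<phi> where w: "nonFR_witness gth \<gamma> G dG X d p \<phi>"
      unfolding nonFR_def by blast
    \<comment> \<open>The given witness itself serves as the expansion; its axioms supply the
      four-point condition and the completeness of balls.\<close>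
    then interpret tree_action G dG X d p \<phi>
      by (intro tree_action_of_K_isoR) (auto simp: nonFR_witness_def)
    have "\<forall>m n. m < n \<longrightarrow> Theta 1 m n struct"
      using w Theta_of_no_fixed_point unfolding nonFR_witness_def by blast
    then show ?thesis using w unfolding nonFR_witness_def by blast
  qed
  then show "\<exists>s::nat. s \<ge> 1 \<and>
      (\<forall>(G :: 'g monoid) dG. nonFR TYPE('x) gth \<gamma> G dG \<longrightarrow>
         (\<exists>(X :: 'x set) d p \<phi>. R_tree X d \<and> isometric_action G X d \<phi> \<and> p \<in> X \<and>
            action_structure G dG X d p \<phi> \<in>
              {M \<in> K_isoR gth \<gamma>. \<forall>m n. m < n \<longrightarrow> Theta s m n M}))"
    by (intro exI[of _ 1]) simp
  show "bountiful (nonFR_structures gth \<gamma> :: ('g, 'x) ball_structure set)"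
    unfolding bountiful_def
  proof (intro ballI allI impI)
    fix M :: "('g, 'x) ball_structure" and C
    assume "M \<in> nonFR_structures gth \<gamma>" and C: "C \<subseteq> points M" "infinite C"
    then obtain G dG X d p \<phi> where M: "M = action_structure G dG X d p \<phi>"
      and w: "nonFR_witness gth \<gamma> G dG X d p \<phi>"
      unfolding nonFR_structures_def by blast
    then interpret tree_action G dG X d p \<phi>
      by (intro tree_action_of_K_isoR) (auto simp: nonFR_witness_def)
    show "\<exists>N\<in>nonFR_structures gth \<gamma>. substructure N M \<and> C \<subseteq> points N \<and>
        density_character N (points N) =o density_character M C"
      unfolding M using w C
      by (intro witness_of_small_density assms(2)) (auto simp: nonFR_witness_def M)
  qed
qed

end
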